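(* Let $(W,S)$ be a Coxeter system with $S$ finite, and let $\mathscr{P}$ be a locally constant partition of $W$ with $|\Phi(\mathscr{P})|<\infty$. Then the simple refinements algorithm applied to $\mathscr{P}$ terminates in finite time, outputting the regular completion $\widehat{\mathscr{P}}$, and moreover $|\widehat{\mathscr{P}}|<\infty$.
   Context: $\ell$ is the length function and $D_L(w)=\{s\in S\mid\ell(sw)=\ell(w)-1\}$. A partition of $W$ is a set of nonempty pairwise disjoint subsets (parts) with union $W$; $|\mathscr{P}|$ is the number of parts; $\mathscr{P}\leq\mathscr{P}'$ means each part of $\mathscr{P}'$ is contained in a part of $\mathscr{P}$. A partition is locally constant if $D_L$ is constant on each part $P$ (common value $D_L(P)$). It is regular if it is locally constant and, for each part $P$ and $s\in S\setminus D_L(P)$, $sP\subseteq P'$ for some part $P'$. The set $\mathscr{P}_{\mathrm{reg}}(W)$ of regular partitions, ordered by $\leq$, is a complete lattice, and the regular completion of $\mathscr{P}$ is $\widehat{\mathscr{P}}=\bigwedge\{\mathscr{R}\in\mathscr{P}_{\mathrm{reg}}(W)\mid\mathscr{P}\leq\mathscr{R}\}$ (meet in $\mathscr{P}_{\mathrm{reg}}(W)$). Roots of a partition: let $V$ be the real vector space with basis $\{\alpha_s\mid s\in S\}$ and form $\langle\alpha_s,\alpha_t\rangle=-\cos(\pi/m_{s,t})$ ($m_{s,t}$ the order of $st$; value $-1$ if $m_{s,t}=\infty$), $W$ acting by $s\lambda=\lambda-2\langle\lambda,\alpha_s\rangle\alpha_s$, $\Phi=\{w\alpha_s\mid w\in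 W,s\in S\}$, and $\Phi^+$ the set of roots that are non-negative combinations of the $\alpha_s$. Then $\Phi(\mathscr{P})$ is the set of roots $\beta\in\Phi^+$ such that there exist parts $P_1\neq P_2$ of $\mathscr{P}$ and elements $w\in P_1$ and $s\in S$ with $ws\in P_2$ and $w\alpha_s=\pm\beta$. Simple refinement: for $\mathscr{P}$ locally constant and $(P,s)\in\mathscr{P}\times S$ with $s\notin D_L(P)$ and $sP$ not contained in any part of $\mathscr{P}$, let $X=\{P'\in\mathscr{P}\mid P'\cap sP\neq\emptyset\}$. The simple refinement of $\mathscr{P}$ based at $(P,s)$ is obtained by replacing the part $P$ by the parts $P\cap sP'$, $P'\in X$. Simple refinements algorithm with input a locally constant partition $\mathscr{P}$: let $\mathscr{P}_0=\mathscr{P}$. For $j\ge1$, if there exists a pair $(P,s)$ with $P\in\mathscr{P}_{j-1}$, $s\in S\setminus D_L(P)$ and $sP$ not contained in any part of $\mathscr{P}_{j-1}$, choose one (arbitrarily) and let $\mathscr{P}_j$ be the simple refinement of $\mathscr{P}_{j-1}$ based at it; otherwise stop and output $\mathscr{P}_{j-1}$. The algorithm terminates in finite time if it stops after finitely many steps (for an arbitrary sequence of choices). *)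

theory Defs
  imports Complex_Main "HOL-Algebra.Algebra" "HOL-Library.Disjoint_Sets"
begin

section \<open>Coxeter systems\<close>

definition word_val :: "('a, 'b) monoid_scheme \<Rightarrow> 'a list \<Rightarrow> 'a" where
  "word_val W ws = foldr (\<otimes>\<^bsub>W\<^esub>) ws \<one>\<^bsub>W\<^esub>"

text \<open>
  The order of \<open>s t\<close>. The value 0 encodes infinite order, as everywhere for
  \<^const>\<open>group.ord\<close>.
\<close>

definition cox_m :: "('a, 'b) monoid_scheme \<Rightarrow> 'a \<Rightarrow> 'a \<Rightarrow> nat" where
  "cox_m W s t = group.ord W (s \<otimes>\<^bsub>W\<^esub> t)"

text \<open>
  Insertion of a relator \<open>(s t)^m(s,t)\<close> into a word over \<open>S\<close>. For infinite order the
  inserted word is empty, so that no relation is imposed. The case \<open>s = t\<close> gives the relation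
  \<open>s s = 1\<close>; because of it every generator is its own inverse and positive words suffice.
\<close>

inductive cox_step :: "('a, 'b) monoid_scheme \<Rightarrow> 'a set \<Rightarrow> 'a list \<Rightarrow> 'a list \<Rightarrow> bool"
  for W S where
  "\<lbrakk>u \<in> lists S; v \<in> lists S; s \<in> S; t \<in> S\<rbrakk> \<Longrightarrow>
     cox_step W S (u @ v) (u @ concat (replicate (cox_m W s t) [s, t]) @ v)"

text \<open>
  \<open>W\<close> is presented by the set \<open>S\<close> of involutions with the relations
  \<open>(s t)^m(s,t) = 1\<close>, where \<open>m(s,t)\<close> is the order of \<open>s t\<close> in \<open>W\<close> (no relation when
  it is infinite): words with equal value are equal modulo these relations.
\<close>

locale coxeter_system = group W for W (structure) +
  fixes S :: "'a set"
  assumes S_subset: "S \<subseteq> carrier W"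
    and S_order: "s \<in> S \<Longrightarrow> ord s = 2"
    and S_generates: "generate W S = carrier W"
    and S_presentation:
      "\<lbrakk>u \<in> lists S; v \<in> lists S; word_val W u = word_val W v\<rbrakk> \<Longrightarrow> equivclp (cox_step W S) u v"

definition cox_length :: "('a, 'b) monoid_scheme \<Rightarrow> 'a set \<Rightarrow> 'a \<Rightarrow> nat" where
  "cox_length W S w = (LEAST n. \<exists>ws \<in> lists S. length ws = n \<and> word_val W ws = w)"

definition left_descents :: "('a, 'b) monoid_scheme \<Rightarrow> 'a set \<Rightarrow> 'a \<Rightarrow> 'a set" where
  "left_descents W S w =
     {s \<in> S. int (cox_length W S (s \<otimes>\<^bsub>W\<^esub> w)) = int (cox_length W S w) - 1}"


section \<open>The root system\<close>

text \<open>
  \<open>V\<close> is realised as the real-valued functions vanishing outside the finite set \<open>S\<close>;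
  the value at \<open>s\<close> is the coefficient of \<open>\<alpha>\<^sub>s\<close>.
\<close>

definition simple_root :: "'a \<Rightarrow> 'a \<Rightarrow> real" where
  "simple_root s = (\<lambda>t. if t = s then 1 else 0)"

definition cox_form_coeff :: "('a, 'b) monoid_scheme \<Rightarrow> 'a \<Rightarrow> 'a \<Rightarrow> real" where
  "cox_form_coeff W s t = (if cox_m W s t = 0 then - 1 else - cos (pi / real (cox_m W s t)))"

definition cox_form ::
  "('a, 'b) monoid_scheme \<Rightarrow> 'a set \<Rightarrow> ('a \<Rightarrow> real) \<Rightarrow> ('a \<Rightarrow> real) \<Rightarrow> real" where
  "cox_form W S x y = (\<Sum>s\<in>S. \<Sum>t\<in>S. x s * y t * cox_form_coeff W s t)"

definition simple_reflection ::
  "('a, 'b) monoid_scheme \<Rightarrow> 'a set \<Rightarrow> 'a \<Rightarrow> ('a \<Rightarrow> real) \<Rightarrow> ('a \<Rightarrow> real)" where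
  "simple_reflection W S s x = (\<lambda>t. x t - 2 * cox_form W S x (simple_root s) * simple_root s t)"

text \<open>
  The action of \<open>W\<close> on \<open>V\<close> extending that of the generators. In a Coxeter system with
  \<open>S\<close> finite, the result does not depend on the chosen word for \<open>w\<close>, since the
  simple reflections satisfy the defining relations of \<open>W\<close>.
\<close>

definition cox_act ::
  "('a, 'b) monoid_scheme \<Rightarrow> 'a set \<Rightarrow> 'a \<Rightarrow> ('a \<Rightarrow> real) \<Rightarrow> ('a \<Rightarrow> real)" where
  "cox_act W S w x =
     foldr (simple_reflection W S) (SOME ws. ws \<in> lists S \<and> word_val W ws = w) x"

definition roots :: "('a, 'b) monoid_scheme \<Rightarrow> 'a set \<Rightarrow> ('a \<Rightarrow> real) set" where
  "roots W S = {cox_act W S w (simple_root s) | w s. w \<in> carrier W \<and> s \<in> S}"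

definition positive_roots :: "('a, 'b) monoid_scheme \<Rightarrow> 'a set \<Rightarrow> ('a \<Rightarrow> real) set" where
  "positive_roots W S = {\<beta> \<in> roots W S. \<forall>s\<in>S. 0 \<le> \<beta> s}"

definition roots_of_partition ::
  "('a, 'b) monoid_scheme \<Rightarrow> 'a set \<Rightarrow> 'a set set \<Rightarrow> ('a \<Rightarrow> real) set" where
  "roots_of_partition W S \<P> =
     {\<beta> \<in> positive_roots W S.
        \<exists>P\<^sub>1\<in>\<P>. \<exists>P\<^sub>2\<in>\<P>. P\<^sub>1 \<noteq> P\<^sub>2 \<and>
          (\<exists>w\<in>P\<^sub>1. \<exists>s\<in>S. w \<otimes>\<^bsub>W\<^esub> s \<in> P\<^sub>2 \<and>
             (cox_act W S w (simple_root s) = \<beta> \<or>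
              cox_act W S w (simple_root s) = (\<lambda>t. - \<beta> t)))}"


section \<open>Locally constant and regular partitions\<close>

definition locally_constant ::
  "('a, 'b) monoid_scheme \<Rightarrow> 'a set \<Rightarrow> 'a set set \<Rightarrow> bool" where
  "locally_constant W S \<P> \<longleftrightarrow>
     partition_on (carrier W) \<P> \<and>
     (\<forall>P\<in>\<P>. \<forall>v\<in>P. \<forall>w\<in>P. left_descents W S v = left_descents W S w)"

text \<open>The common value of the left descent sets; meaningful for parts of a locally constant partition.\<close>

definition part_descents ::
  "('a, 'b) monoid_scheme \<Rightarrow> 'a set \<Rightarrow> 'a set \<Rightarrow> 'a set" where
  "part_descents W S P = (THE D. \<forall>w\<in>P. left_descents W S w = D)"

definition regular_partition ::
  "('a, 'b) monoid_scheme \<Rightarrow> 'a set \<Rightarrow> 'a set set \<Rightarrow> bool" where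
  "regular_partition W S \<P> \<longleftrightarrow>
     locally_constant W S \<P> \<and>
     (\<forall>P\<in>\<P>. \<forall>s\<in>S - part_descents W S P. \<exists>P'\<in>\<P>. s <#\<^bsub>W\<^esub> P \<subseteq> P')"

text \<open>
  Partitions are ordered by \<open>\<P> \<le> \<P>'\<close> iff \<open>\<P>'\<close> refines \<open>\<P>\<close>: finer partitions are
  larger. Note the reversed arguments of \<^const>\<open>refines\<close>.
\<close>

definition partition_le ::
  "('a, 'b) monoid_scheme \<Rightarrow> 'a set set \<Rightarrow> 'a set set \<Rightarrow> bool" where
  "partition_le W \<P> \<P>' \<longleftrightarrow> refines (carrier W) \<P>' \<P>"

definition regular_partitions ::
  "('a, 'b) monoid_scheme \<Rightarrow> 'a set \<Rightarrow> 'a set set gorder" where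
  "regular_partitions W S =
     \<lparr>carrier = {\<R>. regular_partition W S \<R>}, eq = (=), le = partition_le W\<rparr>"

definition regular_completion ::
  "('a, 'b) monoid_scheme \<Rightarrow> 'a set \<Rightarrow> 'a set set \<Rightarrow> 'a set set" where
  "regular_completion W S \<P> =
     \<Sqinter>\<^bsub>regular_partitions W S\<^esub>
       {\<R> \<in> carrier (regular_partitions W S). partition_le W \<P> \<R>}"


section \<open>The simple refinements algorithm\<close>

definition refinable_at ::
  "('a, 'b) monoid_scheme \<Rightarrow> 'a set \<Rightarrow> 'a set set \<Rightarrow> 'a set \<Rightarrow> 'a \<Rightarrow> bool" where
  "refinable_at W S \<P> P s \<longleftrightarrow>
     P \<in> \<P> \<and> s \<in> S - part_descents W S P \<and> \<not> (\<exists>P'\<in>\<P>. s <#\<^bsub>W\<^esub> P \<subseteq> P')"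

definition simple_refinement ::
  "('a, 'b) monoid_scheme \<Rightarrow> 'a set set \<Rightarrow> 'a set \<Rightarrow> 'a \<Rightarrow> 'a set set" where
  "simple_refinement W \<P> P s =
     (\<P> - {P}) \<union> {P \<inter> (s <#\<^bsub>W\<^esub> P') | P'. P' \<in> \<P> \<and> P' \<inter> (s <#\<^bsub>W\<^esub> P) \<noteq> {}}"

definition refinement_step ::
  "('a, 'b) monoid_scheme \<Rightarrow> 'a set \<Rightarrow> 'a set set \<Rightarrow> 'a set set \<Rightarrow> bool" where
  "refinement_step W S \<P> \<Q> \<longleftrightarrow>
     (\<exists>P s. refinable_at W S \<P> P s \<and> \<Q> = simple_refinement W \<P> P s)"

text \<open>The algorithm is nondeterministic; termination means that no sequence of choices runs forever.\<close>

definition algorithm_terminates ::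
  "('a, 'b) monoid_scheme \<Rightarrow> 'a set \<Rightarrow> 'a set set \<Rightarrow> bool" where
  "algorithm_terminates W S \<P> \<longleftrightarrow>
     \<not> (\<exists>\<Q>. \<Q> 0 = \<P> \<and> (\<forall>j. refinement_step W S (\<Q> j) (\<Q> (Suc j))))"

text \<open>\<open>\<Q>\<close> is a possible output on input \<open>\<P>\<close>, for some sequence of choices.\<close>

definition algorithm_output ::
  "('a, 'b) monoid_scheme \<Rightarrow> 'a set \<Rightarrow> 'a set set \<Rightarrow> 'a set set \<Rightarrow> bool" where
  "algorithm_output W S \<P> \<Q> \<longleftrightarrow>
     (refinement_step W S)\<^sup>*\<^sup>* \<P> \<Q> \<and> \<not> (\<exists>P s. refinable_at W S \<Q> P s)"

end

(*
  By root positivity the parts of a partition with set of roots A are unions of regions of the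
  walls of A, because a minimal gallery crosses only walls separating its ends. Hence it suffices
  to find a finite set B of positive roots containing A and the simple roots such that the regions
  of the walls of B form a regular partition: this finite regular partition bounds the number of
  parts along every run of the algorithm, and each simple refinement stays below every regular
  partition above the input. For B one can take the roots dominating at most n roots, n large:
  if b lies in B and <b, a_s> > -1 then s b lies in B, and if <b, a_s> <= -1 then s b dominates
  the simple root a_s, so s b is not inverted by an element without left descent s.

  Finiteness of B reduces to n = 0 (elementary roots), since a root b dominating an elementary
  root a is the reflection in a of a root dominating fewer roots than b. The elementary roots are
  reached from the simple ones by short ascents, and an infinite path of ascents would contain two
  roots with inner product 1, hence one dominating the other. This uses that inner products of
  roots in (-1, 1) take finitely many values: two roots with such an inner product are conjugate
  into a finite standard parabolic root system.
*)
theory Submission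
  imports Defs
begin

text \<open>Closing the roots of the input under all simple reflections is hopeless when W is
  infinite. The closure has to be cut off by a quantity that does not grow along the steps from
  \<beta> to s\<beta> with \<langle>\<beta>, \<alpha>_s\<rangle> > -1. The number of dominated roots
  is one: s carries every root dominated by s\<beta> to a positive root dominated by \<beta>. It is
  finite because some element inverts \<beta>, and that element inverts only finitely many positive
  roots. The form may be indefinite or degenerate, so there are no angles to argue with. Their
  substitute is the recurrence h(n+2) = 2c h(n+1) - h(n), satisfied by every linear functional along
  the dihedral string of two roots with inner product c. For c < 1 no solution stays positive, which
  bars dominance; for c \<ge> 1 a positive solution that does not drop at the start never drops, and
  a failure of dominance would give an element with infinitely many inversions. The same recurrence,
  for powers of a rotation, replaces compactness of the orthogonal group when inner products in (-1,
  1) are counted.\<close>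

locale finite_coxeter_system = coxeter_system +
  assumes finite_S: "finite S"

section \<open>Words, lengths and parity\<close>

context coxeter_system
begin

abbreviation val :: "'a list \<Rightarrow> 'a" where "val \<equiv> word_val W"
abbreviation len :: "'a \<Rightarrow> nat" where "len \<equiv> cox_length W S"

lemma S_carrier [simp, intro]: "s \<in> S \<Longrightarrow> s \<in> carrier W"
  using S_subset by auto

lemma S_square [simp]: "s \<in> S \<Longrightarrow> s \<otimes> s = \<one>"
  using pow_ord_eq_1[of s] S_order[of s] by (simp add: numeral_2_eq_2)

lemma S_inv [simp]: "s \<in> S \<Longrightarrow> inv s = s"
  by (rule inv_equality) auto

lemma S_cancel_left [simp]: "\<lbrakk>s \<in> S; w \<in> carrier W\<rbrakk> \<Longrightarrow> s \<otimes> (s \<otimes> w) = w"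
  by (simp flip: m_assoc)

lemma S_cancel_right [simp]: "\<lbrakk>s \<in> S; w \<in> carrier W\<rbrakk> \<Longrightarrow> w \<otimes> s \<otimes> s = w"
  by (simp add: m_assoc)

lemma val_Nil [simp]: "val [] = \<one>"
  by (simp add: word_val_def)

lemma val_Cons [simp]: "val (s # ws) = s \<otimes> val ws"
  by (simp add: word_val_def)

lemma val_closed [simp, intro]: "ws \<in> lists S \<Longrightarrow> val ws \<in> carrier W"
  by (induction ws) auto

lemma val_append [simp]:
  "\<lbrakk>u \<in> lists S; v \<in> lists S\<rbrakk> \<Longrightarrow> val (u @ v) = val u \<otimes> val v"
  by (induction u) (auto simp: m_assoc)

lemma val_rev: "ws \<in> lists S \<Longrightarrow> val (rev ws) = inv (val ws)"
  by (induction ws) (auto simp: inv_mult_group in_listsI)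

lemma ex_word:
  assumes "w \<in> carrier W"
  obtains ws where "ws \<in> lists S" "val ws = w"
proof -
  have "w \<in> generate W S" using assms S_generates by simp
  then have "\<exists>ws\<in>lists S. val ws = w"
  proof (induction rule: generate.induct)
    case one
    show ?case by (rule bexI[of _ "[]"]) auto
  next
    case (incl h)
    then show ?case by (intro bexI[of _ "[h]"]) auto
  next
    case (inv h)
    then show ?case by (intro bexI[of _ "[h]"]) auto
  next
    case (eng h1 h2)
    then obtain u v where "u \<in> lists S" "val u = h1" "v \<in> lists S" "val v = h2" by auto
    then show ?case by (intro bexI[of _ "u @ v"]) auto
  qed
  then show ?thesis using that by auto
qed

lemma len_le: "ws \<in> lists S \<Longrightarrow> len (val ws) \<le> length ws"
  unfolding cox_length_def by (rule Least_le) auto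

lemma ex_reduced:
  assumes "w \<in> carrier W"
  obtains ws where "ws \<in> lists S" "val ws = w" "length ws = len w"
proof -
  obtain ws where "ws \<in> lists S" "val ws = w" using ex_word assms by blast
  then have "\<exists>n. \<exists>ws\<in>lists S. length ws = n \<and> val ws = w" by auto
  from LeastI_ex[OF this] show ?thesis
    using that unfolding cox_length_def by auto
qed

lemma len_one [simp]: "len \<one> = 0"
  using len_le[of "[]"] by simp

lemma len_inv [simp]:
  assumes "w \<in> carrier W"
  shows "len (inv w) = len w"
proof -
  have le: "len (inv v) \<le> len v" if v: "v \<in> carrier W" for v
  proof -
    obtain ws where "ws \<in> lists S" "val ws = v" "length ws = len v"
      using ex_reduced v by blast
    then show ?thesis using len_le[of "rev ws"] by (auto simp: val_rev in_listsI)
  qed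
  have "len w \<le> len (inv w)" using le[of "inv w"] assms by simp
  then show ?thesis using le[OF assms] by (rule order.antisym[rotated])
qed

lemma len_mult_word_le:
  assumes "w \<in> carrier W" "ws \<in> lists S"
  shows "len (w \<otimes> val ws) \<le> len w + length ws"
proof -
  obtain u where "u \<in> lists S" "val u = w" "length u = len w" using ex_reduced assms by blast
  then show ?thesis using len_le[of "u @ ws"] assms by auto
qed

lemma len_mult_le: "\<lbrakk>w \<in> carrier W; s \<in> S\<rbrakk> \<Longrightarrow> len (w \<otimes> s) \<le> len w + 1"
  using len_mult_word_le[of w "[s]"] by simp

lemma cox_step_parity: "cox_step W S u v \<Longrightarrow> even (length u) = even (length v)"
  by (induction rule: cox_step.induct) (auto simp: length_concat sum_list_replicate)

text \<open>The sign character: inserted relators have even length 2m(s,t), and length 0 for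
  infinite order. It rules out that w and ws have equal lengths.\<close>

lemma word_parity:
  assumes "u \<in> lists S" "v \<in> lists S" "val u = val v"
  shows "even (length u) = even (length v)"
proof -
  have "equivclp (cox_step W S) u v" using S_presentation assms by blast
  then show ?thesis
    by (induction rule: equivclp_induct) (auto dest: cox_step_parity)
qed

lemma len_mult_neq:
  assumes "w \<in> carrier W" "s \<in> S"
  shows "len (w \<otimes> s) \<noteq> len w"
proof -
  obtain u where u: "u \<in> lists S" "val u = w" "length u = len w" using ex_reduced assms by blast
  obtain v where v: "v \<in> lists S" "val v = w \<otimes> s" "length v = len (w \<otimes> s)"
    using ex_reduced[of "w \<otimes> s"] assms by blast
  show ?thesis using word_parity[of "u @ [s]" v] u v assms by auto
qed

lemma len_mult_cases:
  assumes "w \<in> carrier W" "s \<in> S"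
  shows "len (w \<otimes> s) = len w + 1 \<or> len w = len (w \<otimes> s) + 1"
  using len_mult_neq[OF assms] len_mult_le[OF assms] len_mult_le[of "w \<otimes> s" s] assms by auto

lemma ex_right_descent:
  assumes "w \<in> carrier W" "w \<noteq> \<one>"
  obtains s where "s \<in> S" "len w = len (w \<otimes> s) + 1"
proof -
  obtain ws where ws: "ws \<in> lists S" "val ws = w" "length ws = len w" using ex_reduced assms by blast
  with assms(2) have "ws \<noteq> []" by auto
  then obtain u s where us: "ws = u @ [s]" using rev_exhaust by blast
  then have s: "s \<in> S" and u: "u \<in> lists S" using ws by auto
  have "w \<otimes> s = val u" using ws(2) u s by (auto simp: us in_listsI)
  then have "len (w \<otimes> s) < len w" using len_le[OF u] ws us by simp
  then show ?thesis using that s len_mult_cases[OF assms(1) s] by auto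
qed

end

section \<open>The geometric representation\<close>

text \<open>All linearity statements go through this two-term combination: the form, the
  reflections, the action and the height are each shown to respect it.\<close>

definition lc :: "real \<Rightarrow> ('a \<Rightarrow> real) \<Rightarrow> real \<Rightarrow> ('a \<Rightarrow> real) \<Rightarrow> 'a \<Rightarrow> real" where
  "lc a x b y = (\<lambda>t. a * x t + b * y t)"

lemma lc_apply: "lc a x b y t = a * x t + b * y t"
  by (simp add: lc_def)

context coxeter_system
begin

abbreviation form :: "('a \<Rightarrow> real) \<Rightarrow> ('a \<Rightarrow> real) \<Rightarrow> real" where "form \<equiv> cox_form W S"
abbreviation refl :: "'a \<Rightarrow> ('a \<Rightarrow> real) \<Rightarrow> 'a \<Rightarrow> real" where "refl \<equiv> simple_reflection W S"
abbreviation act :: "'a \<Rightarrow> ('a \<Rightarrow> real) \<Rightarrow> 'a \<Rightarrow> real" where "act \<equiv> cox_act W S"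

text \<open>The coefficients of a root turn out to have one sign, so the sign of this single linear
  functional decides positivity. Statements about inversions thus become inequalities between real
  numbers.\<close>

definition ht :: "('a \<Rightarrow> real) \<Rightarrow> real" where
  "ht x = (\<Sum>s\<in>S. x s)"

lemma ht_lc: "ht (lc a x b y) = a * ht x + b * ht y"
  by (simp add: ht_def lc_def sum.distrib sum_distrib_left)

lemma form_lc_left: "form (lc a x b y) z = a * form x z + b * form y z"
  by (simp add: cox_form_def lc_def algebra_simps sum.distrib sum_distrib_left)

lemma form_lc_right: "form z (lc a x b y) = a * form z x + b * form z y"
  by (simp add: cox_form_def lc_def algebra_simps sum.distrib sum_distrib_left)

lemmas form_lc = form_lc_left form_lc_right

lemma ord_mult_commute:
  assumes "s \<in> S" "t \<in> S"
  shows "cox_m W s t = cox_m W t s"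
proof -
  have "t \<otimes> s = inv (s \<otimes> t)" using assms by (simp add: inv_mult_group)
  then show ?thesis using ord_inv[of "s \<otimes> t"] assms by (simp add: cox_m_def)
qed

lemma form_commute: "form x y = form y x"
proof -
  have c: "cox_form_coeff W s t = cox_form_coeff W t s" if "s \<in> S" "t \<in> S" for s t
    using ord_mult_commute[OF that] by (simp add: cox_form_coeff_def)
  have "form x y = (\<Sum>t\<in>S. \<Sum>s\<in>S. x s * y t * cox_form_coeff W s t)"
    unfolding cox_form_def by (rule sum.swap)
  also have "\<dots> = form y x"
    unfolding cox_form_def by (intro sum.cong refl) (simp add: c mult.commute)
  finally show ?thesis .
qed

lemma cox_m_same: "s \<in> S \<Longrightarrow> cox_m W s s = 1"
  by (simp add: cox_m_def)

lemma cox_m_neq_1: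
  assumes "s \<in> S" "t \<in> S" "s \<noteq> t"
  shows "cox_m W s t \<noteq> 1"
proof
  assume "cox_m W s t = 1"
  then have "s \<otimes> t = \<one>" using pow_ord_eq_1[of "s \<otimes> t"] assms by (simp add: cox_m_def)
  then have "s = inv t" using assms by (intro inv_equality[symmetric]) auto
  then show False using assms by simp
qed

lemma refl_eq_lc: "refl s x = lc 1 x (- 2 * form x (simple_root s)) (simple_root s)"
  by (simp add: simple_reflection_def lc_def)

lemma refl_lc: "refl s (lc a x b y) = lc a (refl s x) b (refl s y)"
  by (rule ext) (simp add: refl_eq_lc form_lc lc_apply algebra_simps)

end

context finite_coxeter_system
begin

lemma form_simple_roots:
  assumes "s \<in> S" "t \<in> S"
  shows "form (simple_root s) (simple_root t) = cox_form_coeff W s t"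
proof -
  have "form (simple_root s) (simple_root t)
      = (\<Sum>s'\<in>S. \<Sum>t'\<in>S. if t' = t then simple_root s s' * cox_form_coeff W s' t else 0)"
    unfolding cox_form_def by (intro sum.cong refl) (simp add: simple_root_def)
  also have "\<dots> = (\<Sum>s'\<in>S. simple_root s s' * cox_form_coeff W s' t)"
    using assms finite_S by simp
  also have "\<dots> = (\<Sum>s'\<in>S. if s' = s then cox_form_coeff W s t else 0)"
    by (intro sum.cong refl) (simp add: simple_root_def)
  also have "\<dots> = cox_form_coeff W s t" using assms finite_S by simp
  finally show ?thesis .
qed

lemma form_simple_same [simp]: "s \<in> S \<Longrightarrow> form (simple_root s) (simple_root s) = 1"
  by (simp add: form_simple_roots cox_form_coeff_def cox_m_same)

lemma form_simple_nonpos: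
  assumes "s \<in> S" "t \<in> S" "s \<noteq> t"
  shows "form (simple_root s) (simple_root t) \<le> 0"
proof (cases "cox_m W s t = 0")
  case False
  then have "2 \<le> cox_m W s t" using cox_m_neq_1[OF assms] by linarith
  then have "pi / real (cox_m W s t) \<le> pi / 2" by (intro divide_left_mono) auto
  then have "cos (pi / real (cox_m W s t)) \<ge> 0"
    by (intro cos_ge_zero) (auto intro: order.trans[of _ 0])
  then show ?thesis using assms False by (simp add: form_simple_roots cox_form_coeff_def)
qed (use assms in \<open>simp add: form_simple_roots cox_form_coeff_def\<close>)

lemma form_expand_left: "form x y = (\<Sum>s\<in>S. x s * form (simple_root s) y)"
proof -
  have "form (simple_root s) y = (\<Sum>t\<in>S. y t * cox_form_coeff W s t)" if "s \<in> S" for s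
  proof -
    have "form (simple_root s) y
        = (\<Sum>s'\<in>S. if s' = s then \<Sum>t\<in>S. y t * cox_form_coeff W s t else 0)"
      unfolding cox_form_def by (intro sum.cong refl) (simp add: simple_root_def)
    then show ?thesis using that finite_S by simp
  qed
  then show ?thesis
    unfolding cox_form_def by (simp add: sum_distrib_left mult.assoc)
qed

lemma refl_refl [simp]: "s \<in> S \<Longrightarrow> refl s (refl s x) = x"
  by (rule ext) (simp add: refl_eq_lc form_lc lc_apply)

lemma form_refl: "s \<in> S \<Longrightarrow> form (refl s x) (refl s y) = form x y"
  by (simp add: refl_eq_lc form_lc form_commute[of "simple_root s" y] form_commute[of "simple_root s" x] algebra_simps)

end

text \<open>
  The coefficients of the roots of a dihedral group: Chebyshev polynomials of the second kind,
  shifted by one so that \<open>cheb c 0 = 0\<close>.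
\<close>

fun cheb :: "real \<Rightarrow> nat \<Rightarrow> real" where
  "cheb c 0 = 0"
| "cheb c (Suc 0) = 1"
| "cheb c (Suc (Suc n)) = 2 * c * cheb c (Suc n) - cheb c n"

lemma cheb_cos:
  assumes "sin \<theta> \<noteq> 0"
  shows "cheb (cos \<theta>) n * sin \<theta> = sin (real n * \<theta>)"
proof (induction "cos \<theta>" n rule: cheb.induct)
  case (3 n)
  define x where "x = real (Suc n) * \<theta>"
  have e: "real (Suc (Suc n)) * \<theta> = x + \<theta>" "real n * \<theta> = x - \<theta>"
    by (auto simp: x_def algebra_simps)
  have "cheb (cos \<theta>) (Suc (Suc n)) * sin \<theta>
      = 2 * cos \<theta> * (cheb (cos \<theta>) (Suc n) * sin \<theta>) - cheb (cos \<theta>) n * sin \<theta>"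
    by (simp add: algebra_simps)
  also have "\<dots> = 2 * cos \<theta> * sin x - sin (x - \<theta>)"
    using 3 e by (simp add: x_def)
  also have "\<dots> = sin (real (Suc (Suc n)) * \<theta>)"
    unfolding e by (simp add: sin_add sin_diff)
  finally show ?case .
qed auto

lemma cheb_1: "cheb 1 n = real n"
  by (induction "1 :: real" n rule: cheb.induct) auto

section \<open>The Coxeter relations for the simple reflections, and the action of W\<close>

context finite_coxeter_system
begin

definition cox_c :: "'a \<Rightarrow> 'a \<Rightarrow> real" where
  "cox_c s t = - form (simple_root s) (simple_root t)"

lemma cox_c_commute: "cox_c s t = cox_c t s"
  by (simp add: cox_c_def form_commute)

lemma cox_c_eq:
  "\<lbrakk>s \<in> S; t \<in> S\<rbrakk> \<Longrightarrow> cox_c s t = (if cox_m W s t = 0 then 1 else cos (pi / real (cox_m W s t)))"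
  by (simp add: cox_c_def form_simple_roots cox_form_coeff_def)

lemma refl_dihedral_plane:
  assumes "s \<in> S" "t \<in> S"
  shows "refl s (lc a (simple_root s) b (simple_root t))
       = lc (2 * cox_c s t * b - a) (simple_root s) b (simple_root t)"
  by (rule ext) (use assms in \<open>simp add: refl_eq_lc form_lc lc_apply cox_c_def
      form_commute[of "simple_root t" "simple_root s"] algebra_simps\<close>)

lemma lc_swap: "lc a x b y = lc b y a x"
  by (auto simp: lc_def)

text \<open>Reflecting in t replaces the Chebyshev index 2k at \<alpha>_t by 2k + 2; reflecting in s
  then replaces the index 2k + 1 at \<alpha>_s by 2k + 3. Both are instances of the three-term
  recurrence.\<close>

lemma dihedral_pow_root:
  assumes "s \<in> S" "t \<in> S"
  shows "((refl s \<circ> refl t) ^^ k) (simple_root s)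
       = lc (cheb (cox_c s t) (2 * k + 1)) (simple_root s) (cheb (cox_c s t) (2 * k)) (simple_root t)"
proof -
  define P where "P = refl s \<circ> refl t"
  define p where "p = cheb (cox_c s t)"
  have "(P ^^ k) (simple_root s) = lc (p (2 * k + 1)) (simple_root s) (p (2 * k)) (simple_root t)"
  proof (induction k)
    case 0
    show ?case by (auto simp: lc_def p_def)
  next
    case (Suc k)
    have p: "p (Suc (Suc n)) = 2 * cox_c s t * p (Suc n) - p n" for n by (simp add: p_def)
    have "(P ^^ Suc k) (simple_root s)
        = P (lc (p (2 * k + 1)) (simple_root s) (p (2 * k)) (simple_root t))"
      by (simp add: Suc)
    also have "\<dots> = refl s (refl t (lc (p (2 * k)) (simple_root t) (p (2 * k + 1)) (simple_root s)))"
      by (simp add: P_def lc_swap[of _ "simple_root s" _ "simple_root t"])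
    also have "\<dots> = refl s (lc (p (2 * k + 1)) (simple_root s) (p (2 * k + 2)) (simple_root t))"
      using assms
      by (simp add: refl_dihedral_plane cox_c_commute[of t s] p
          lc_swap[of _ "simple_root s" _ "simple_root t"])
    also have "\<dots> = lc (p (2 * Suc k + 1)) (simple_root s) (p (2 * Suc k)) (simple_root t)"
      using assms by (simp add: refl_dihedral_plane p)
    finally show ?case .
  qed
  then show ?thesis by (simp add: P_def p_def)
qed

lemma pow_lc:
  "((refl s \<circ> refl t) ^^ k) (lc a x b y)
     = lc a (((refl s \<circ> refl t) ^^ k) x) b (((refl s \<circ> refl t) ^^ k) y)"
  by (induction k) (simp_all add: refl_lc)

text \<open>For finite m > 1 the plane of \<alpha>_s and \<alpha>_t is positive definite, so a
  vector splits into a part orthogonal to both, fixed by both reflections, and a part in the plane,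
  where the power is trivial because the Chebyshev values at 2m and 2m + 1 are 0 and 1.\<close>

lemma dihedral_relation:
  assumes st: "s \<in> S" "t \<in> S" and m: "cox_m W s t \<noteq> 0"
  shows "((refl s \<circ> refl t) ^^ cox_m W s t) x = x"
proof (cases "s = t")
  case True
  then show ?thesis using st by (simp add: cox_m_same)
next
  case False
  define m where "m = cox_m W s t"
  define \<theta> where "\<theta> = pi / real m"
  have m2: "2 \<le> m" using cox_m_neq_1[OF st False] m by (simp add: m_def)
  then have \<theta>: "0 < \<theta>" "\<theta> < pi" by (auto simp: \<theta>_def field_simps)
  then have sin: "sin \<theta> > 0" by (intro sin_gt_zero)
  define c where "c = cox_c s t"
  have c: "c = cos \<theta>" using st m by (simp add: c_def cox_c_eq \<theta>_def m_def)
  have \<theta>m: "real (2 * m) * \<theta> = 2 * pi" using m2 by (simp add: \<theta>_def)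
  then have e: "real (2 * m + 1) * \<theta> = 2 * pi + \<theta>" by (simp add: algebra_simps)
  have p0: "cheb c (2 * m) = 0"
    using cheb_cos[of \<theta> "2 * m"] sin unfolding \<theta>m c by simp
  have "cheb c (2 * m + 1) * sin \<theta> = sin (2 * pi + \<theta>)"
    using cheb_cos[of \<theta> "2 * m + 1"] sin by (simp only: c e)
  then have p1: "cheb c (2 * m + 1) = 1" using sin by (simp add: sin_add)
  let ?R = "\<lambda>k. (refl s \<circ> refl t) ^^ k"
  have Rs: "?R m (simple_root s) = simple_root s"
    using dihedral_pow_root[OF st, of m] p0 p1 by (simp add: c_def[symmetric] lc_def)
  \<comment> \<open>\<open>dihedral_pow_root\<close> treats only the root whose reflection is
    applied last. The other root is fixed by the power of the inverse rotation, hence by that of the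
    rotation.\<close>
  have Qt: "((refl t \<circ> refl s) ^^ m) (simple_root t) = simple_root t"
    using dihedral_pow_root[OF st(2,1), of m] p0 p1
    by (simp add: c_def[symmetric] lc_def cox_c_commute[of t s])
  have inv: "?R k (((refl t \<circ> refl s) ^^ k) y) = y" for k y
  proof -
    define P Q where "P = refl s \<circ> refl t" and "Q = refl t \<circ> refl s"
    have PQ: "P (Q z) = z" for z using st by (simp add: P_def Q_def)
    have "(P ^^ k) ((Q ^^ k) y) = y"
    proof (induction k arbitrary: y)
      case (Suc k)
      have "(P ^^ Suc k) ((Q ^^ Suc k) y) = (P ^^ k) (P (Q ((Q ^^ k) y)))"
        by (simp add: funpow_swap1)
      then show ?case by (simp add: PQ Suc)
    qed simp
    then show ?thesis by (simp add: P_def Q_def)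
  qed
  have Rt: "?R m (simple_root t) = simple_root t"
    using inv[of m "simple_root t"] Qt by simp
  define d where "d = 1 - c\<^sup>2"
  have "c\<^sup>2 + (sin \<theta>)\<^sup>2 = 1" by (simp add: c)
  then have d: "d > 0" using sin zero_less_power[of "sin \<theta>" 2] unfolding d_def by linarith
  \<comment> \<open>Coordinates of the orthogonal projection of \<open>x\<close> to the plane, by
    Cramer's rule; \<open>d\<close> is the determinant of the Gram matrix of \<alpha>_s and
    \<alpha>_t.\<close>
  define a where "a = (form x (simple_root s) + c * form x (simple_root t)) / d"
  define b where "b = (form x (simple_root t) + c * form x (simple_root s)) / d"
  define z where "z = lc 1 x (- 1) (lc a (simple_root s) b (simple_root t))"
  have f: "form (simple_root s) (simple_root t) = - c" "form (simple_root t) (simple_root s) = - c"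
    by (simp_all add: c_def cox_c_def form_commute)
  have ad: "a * d = form x (simple_root s) + c * form x (simple_root t)"
    "b * d = form x (simple_root t) + c * form x (simple_root s)"
    using d by (simp_all add: a_def b_def)
  have "a * d - c * (b * d) = d * form x (simple_root s)"
    unfolding ad by (simp add: d_def algebra_simps power2_eq_square)
  then have "d * (a - c * b) = d * form x (simple_root s)" by (simp add: algebra_simps)
  then have "a - c * b = form x (simple_root s)" using d by simp
  then have "form z (simple_root s) = 0"
    using st by (simp add: z_def form_lc f algebra_simps)
  moreover have "b * d - c * (a * d) = d * form x (simple_root t)"
    unfolding ad by (simp add: d_def algebra_simps power2_eq_square)
  then have "d * (b - c * a) = d * form x (simple_root t)" by (simp add: algebra_simps)
  then have "b - c * a = form x (simple_root t)" using d by simp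
  then have "form z (simple_root t) = 0"
    using st by (simp add: z_def form_lc f algebra_simps)
  ultimately have "refl s z = z" "refl t z = z" by (simp_all add: refl_eq_lc lc_def)
  then have Rz: "?R k z = z" for k by (induction k) auto
  have x: "x = lc 1 z 1 (lc a (simple_root s) b (simple_root t))"
    by (auto simp: z_def lc_def)
  have "?R m x = x"
    by (subst (1 2) x) (simp add: pow_lc Rz Rs Rt)
  then show ?thesis by (simp add: m_def)
qed

lemma foldr_refl_concat:
  "foldr refl (concat (replicate k [s, t])) x = ((refl s \<circ> refl t) ^^ k) x"
  by (induction k) auto

lemma cox_step_foldr: "cox_step W S u v \<Longrightarrow> foldr refl u = foldr refl v"
proof (induction rule: cox_step.induct)
  case (1 u v s t)
  show ?case
  proof (cases "cox_m W s t = 0")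
    case False
    show ?thesis
      using dihedral_relation[OF 1(3,4) False] by (auto simp: foldr_refl_concat)
  qed simp
qed

text \<open>Makes the word chosen in \<open>cox_act\<close> irrelevant: relators act trivially, so
  words that are equivalent in the presentation act alike.\<close>

lemma foldr_refl_eqI:
  assumes "u \<in> lists S" "v \<in> lists S" "val u = val v"
  shows "foldr refl u = foldr refl v"
proof -
  have "equivclp (cox_step W S) u v" using S_presentation assms by blast
  then show ?thesis
    by (induction rule: equivclp_induct) (auto dest: cox_step_foldr)
qed

lemma act_val: 
  assumes "ws \<in> lists S"
  shows "act (val ws) x = foldr refl ws x"
proof -
  let ?u = "SOME u. u \<in> lists S \<and> val u = val ws"
  have "?u \<in> lists S \<and> val ?u = val ws" by (rule someI[of _ ws]) (use assms in auto)
  then show ?thesis using foldr_refl_eqI[of ?u ws] assms unfolding cox_act_def by simp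
qed

lemma act_one [simp]: "act \<one> x = x"
  using act_val[of "[]"] by simp

lemma act_mult:
  assumes "v \<in> carrier W" "w \<in> carrier W"
  shows "act (v \<otimes> w) x = act v (act w x)"
proof -
  obtain a where a: "a \<in> lists S" "val a = v" using ex_word assms by blast
  obtain b where b: "b \<in> lists S" "val b = w" using ex_word assms by blast
  show ?thesis using act_val[of "a @ b" x] act_val[of a] act_val[of b] a b by auto
qed

lemma act_S: "s \<in> S \<Longrightarrow> act s x = refl s x"
  using act_val[of "[s]" x] by simp

lemma act_inv_act [simp]: "w \<in> carrier W \<Longrightarrow> act (inv w) (act w x) = x"
  by (simp flip: act_mult)

lemma act_act_inv [simp]: "w \<in> carrier W \<Longrightarrow> act w (act (inv w) x) = x"
  by (simp flip: act_mult)

lemma act_lc: 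
  assumes "w \<in> carrier W"
  shows "act w (lc a x b y) = lc a (act w x) b (act w y)"
proof -
  obtain ws where ws: "ws \<in> lists S" "val ws = w" using ex_word assms by blast
  have "foldr refl u (lc a x b y) = lc a (foldr refl u x) b (foldr refl u y)" for u
    by (induction u) (auto simp: refl_lc)
  then show ?thesis using ws act_val[OF ws(1)] by simp
qed

lemma form_act:
  assumes "w \<in> carrier W"
  shows "form (act w x) (act w y) = form x y"
proof -
  obtain ws where ws: "ws \<in> lists S" "val ws = w" using ex_word assms by blast
  have "u \<in> lists S \<Longrightarrow> form (foldr refl u x) (foldr refl u y) = form x y" for u
    by (induction u) (auto simp: form_refl)
  then show ?thesis using ws act_val[OF ws(1)] by simp
qed

lemma form_act_left: "w \<in> carrier W \<Longrightarrow> form (act w x) y = form x (act (inv w) y)"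
  using form_act[of w x "act (inv w) y"] by simp

end

text \<open>With c = cos \<theta> and \<theta> = pi / m the value is sin (n \<theta>) / sin
  \<theta>, and n \<theta> does not exceed pi for n \<le> m. The case c = 1 stands for infinite
  m.\<close>

lemma cheb_nonneg:
  assumes "c = 1 \<or> (\<exists>m\<ge>2. c = cos (pi / real m) \<and> n \<le> m)"
  shows "cheb c n \<ge> 0"
  using assms
proof
  assume "\<exists>m\<ge>2. c = cos (pi / real m) \<and> n \<le> m"
  then obtain m where m: "m \<ge> 2" "c = cos (pi / real m)" "n \<le> m" by blast
  define \<theta> where "\<theta> = pi / real m"
  have \<theta>: "0 < \<theta>" "\<theta> < pi" using m by (auto simp: \<theta>_def field_simps)
  then have sin: "sin \<theta> > 0" by (intro sin_gt_zero)
  have "real n * \<theta> \<le> real m * \<theta>" using m \<theta> by (intro mult_right_mono) auto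
  then have "real n * \<theta> \<le> pi" using m by (simp add: \<theta>_def)
  then have "sin (real n * \<theta>) \<ge> 0" using \<theta> by (intro sin_ge_zero) auto
  then have "cheb c n * sin \<theta> \<ge> 0" using cheb_cos[of \<theta> n] sin m(2) by (simp add: \<theta>_def)
  then show ?thesis using sin by (simp add: zero_le_mult_iff)
qed (simp add: cheb_1)

section \<open>Root positivity from ascents\<close>

context finite_coxeter_system
begin

definition altword :: "'a \<Rightarrow> 'a \<Rightarrow> nat \<Rightarrow> 'a list" where
  "altword s t k = map (\<lambda>i. if even i then s else t) [0..<k]"

lemma altword_Suc: "altword s t (Suc k) = altword s t k @ [if even k then s else t]"
  by (simp add: altword_def)

lemma altword_0 [simp]: "altword s t 0 = []"
  by (simp add: altword_def)

lemma length_altword [simp]: "length (altword s t k) = k"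
  by (simp add: altword_def)

lemma altword_lists [simp]: "\<lbrakk>s \<in> S; t \<in> S\<rbrakk> \<Longrightarrow> altword s t k \<in> lists S"
  by (auto simp: altword_def)

lemma rev_altword_lists: "\<lbrakk>s \<in> S; t \<in> S\<rbrakk> \<Longrightarrow> rev (altword s t k) \<in> lists S"
  by (auto simp: altword_def)

lemma val_altword_even:
  assumes "s \<in> S" "t \<in> S"
  shows "val (altword s t (2 * k)) = (s \<otimes> t) [^] k"
proof (induction k)
  case (Suc k)
  have "altword s t (2 * Suc k) = altword s t (2 * k) @ [s, t]"
    by (simp add: altword_Suc)
  then show ?case using Suc assms by (simp del: in_lists_conv_set)
qed simp

lemma val_altword_2m:
  assumes "s \<in> S" "t \<in> S"
  shows "val (altword s t (2 * cox_m W s t)) = \<one>"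
  using assms by (simp add: val_altword_even cox_m_def pow_ord_eq_1)

text \<open>
  The longest element of a finite dihedral group has a reduced word ending in either generator:
  split the relator \<open>(s t)\<^sup>m\<close> in the middle.
\<close>

lemma len_mult_altword:
  assumes st: "s \<in> S" "t \<in> S" and v: "v \<in> carrier W" and m: "cox_m W s t = m" "0 < m"
  shows "len (v \<otimes> inv (val (altword s t m)) \<otimes> t) < len v + m"
proof -
  define Z where "Z = altword s t (2 * m)"
  define R where "R = butlast (drop m Z)"
  have Z: "Z \<in> lists S" "val Z = \<one>" "length Z = 2 * m"
    using st m val_altword_2m by (auto simp: Z_def simp del: in_lists_conv_set)
  have take: "take m Z = altword s t m"
    by (simp add: Z_def altword_def take_map)
  have ne: "drop m Z \<noteq> []" using Z m by simp
  have "Z = altword s t (Suc (2 * m - 1))" using m by (simp add: Z_def)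
  then have "last Z = t" using m unfolding altword_Suc by simp
  then have "last (drop m Z) = t" using ne by (simp add: last_drop)
  then have drop: "drop m Z = R @ [t]" using ne by (metis R_def append_butlast_last_id)
  then have Zeq: "Z = altword s t m @ R @ [t]" using take by (metis append_take_drop_id)
  then have R: "R \<in> lists S" using Z by auto
  have lR: "length R = m - 1" using Z by (simp add: R_def)
  have A: "val (altword s t m) \<in> carrier W" using st by (simp del: in_lists_conv_set)
  have Rt: "val R \<otimes> t \<in> carrier W" using R st by (simp del: in_lists_conv_set)
  have "val (altword s t m) \<otimes> (val R \<otimes> t) = \<one>"
    using Z Zeq R st by (simp del: in_lists_conv_set)
  then have "inv (val (altword s t m)) = val R \<otimes> t"
    using A Rt by (metis inv_equality inv_inv inv_closed)
  then have "v \<otimes> inv (val (altword s t m)) \<otimes> t = v \<otimes> val R"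
    using R st v by (simp add: m_assoc del: in_lists_conv_set)
  then show ?thesis using len_mult_word_le[OF v R] lR m by simp
qed

text \<open>The inverse word ends in t, so t acts first on \<alpha>_s and the two reflections then
  alternate. Each raises the lower of the two Chebyshev indices by two.\<close>

lemma act_inv_altword:
  assumes "s \<in> S" "t \<in> S"
  shows "act (inv (val (altword t s k))) (simple_root s) =
    (if even k then lc (cheb (cox_c s t) (Suc k)) (simple_root s) (cheb (cox_c s t) k) (simple_root t)
     else lc (cheb (cox_c s t) k) (simple_root s) (cheb (cox_c s t) (Suc k)) (simple_root t))"
proof (induction k)
  case 0
  show ?case by (auto simp: lc_def)
next
  case (Suc k)
  define g where "g = (if even k then t else s)"
  have g: "g \<in> S" using assms by (simp add: g_def)
  have "inv (val (altword t s (Suc k))) = g \<otimes> inv (val (altword t s k))"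
    using assms g by (simp add: altword_Suc g_def[symmetric] inv_mult_group del: in_lists_conv_set)
  then have "act (inv (val (altword t s (Suc k)))) (simple_root s)
      = refl g (act (inv (val (altword t s k))) (simple_root s))"
    using assms g by (simp add: act_mult act_S del: in_lists_conv_set)
  also have "\<dots> = (if even (Suc k) then lc (cheb (cox_c s t) (Suc (Suc k))) (simple_root s) (cheb (cox_c s t) (Suc k)) (simple_root t)
     else lc (cheb (cox_c s t) (Suc k)) (simple_root s) (cheb (cox_c s t) (Suc (Suc k))) (simple_root t))"
  proof (cases "even k")
    case True
    then show ?thesis unfolding Suc g_def using assms
      by (simp add: lc_swap[of _ "simple_root s" _ "simple_root t"] refl_dihedral_plane
          cox_c_commute[of t s])
  next
    case False
    then show ?thesis unfolding Suc g_def using assms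
      by (simp add: refl_dihedral_plane)
  qed
  finally show ?case .
qed

text \<open>Split w into an element that has both s and a right descent t of w as right ascents, and
  a dihedral factor in s and t. The element makes \<alpha>_s and \<alpha>_t non-negative by
  induction, and the factor is short enough to send \<alpha>_s to a non-negative combination of
  these two.\<close>

lemma positive_root_if_ascent:
  assumes "w \<in> carrier W" "s \<in> S" "len w \<le> len (w \<otimes> s)" "r \<in> S"
  shows "0 \<le> act w (simple_root s) r"
  using assms
proof (induction "len w" arbitrary: w s rule: less_induct)
  case less
  show ?case
  proof (cases "w = \<one>")
    case True
    then show ?thesis by (simp add: simple_root_def)
  next
    case False
    then obtain t where t: "t \<in> S" "len w = len (w \<otimes> t) + 1"
      using ex_right_descent less.prems by blast
    have st: "s \<noteq> t" using t less.prems by auto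
    have sS: "s \<in> S" and w: "w \<in> carrier W" using less.prems by auto
    define x where "x k = w \<otimes> val (altword t s k)" for k
    have A: "val (altword t s k) \<in> carrier W" for k
      using sS t by (simp del: in_lists_conv_set)
    have x: "x k \<in> carrier W" for k using w A by (simp add: x_def)
    have x_Suc: "x (Suc k) = x k \<otimes> (if even k then t else s)" for k
      using w A[of k] sS t by (simp add: x_def altword_Suc m_assoc del: in_lists_conv_set)
    have len_w: "len w \<le> len (x j) + j" for j
    proof -
      have "w = x j \<otimes> val (rev (altword t s j))"
        using w A[of j] sS t by (simp add: x_def val_rev m_assoc del: in_lists_conv_set)
      then show ?thesis
        using len_mult_word_le[OF x[of j] rev_altword_lists[OF t(1) sS, of j]] by simp
    qed
    \<comment> \<open>\<open>x k\<close> arises from \<open>w\<close> by multiplying with the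
      letters t, s, t, ... on the right. Each letter shortens by at most one, so \<open>k\<close>
      lies in \<open>K\<close> iff all of the first \<open>k\<close> letters shorten.\<close>
    define K where "K = {k. len (x k) + k = len w}"
    have K: "K \<subseteq> {..len w}" by (auto simp: K_def)
    then have finK: "finite K" using finite_subset by blast
    have "x 1 = w \<otimes> t" using x_Suc[of 0] w by (simp add: x_def)
    then have 1: "1 \<in> K" using t by (simp add: K_def)
    define k where "k = Max K"
    have kK: "k \<in> K" unfolding k_def using finK 1 by (intro Max_in) auto
    have k1: "1 \<le> k" unfolding k_def using finK 1 by simp
    have "Suc k \<notin> K" using Max_ge[OF finK, of "Suc k"] unfolding k_def by linarith
    then have "len (x (Suc k)) + Suc k \<noteq> len w" by (simp add: K_def)
    moreover have "len (x k) + k = len w" using kK by (simp add: K_def)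
    moreover have "len (x (Suc k)) = len (x k) + 1 \<or> len (x k) = len (x (Suc k)) + 1"
      unfolding x_Suc using len_mult_cases[OF x[of k], of "if even k then t else s"] sS t by auto
    ultimately have up: "len (x k) \<le> len (x (Suc k))" by linarith
    obtain j where j: "k = Suc j" using k1 by (cases k) auto
    have "x k \<otimes> (if even j then t else s) = x j"
      unfolding j x_Suc using x[of j] sS t by auto
    then have down: "len (x k) \<le> len (x k \<otimes> (if even j then t else s))"
      using kK j len_w[of j] by (simp add: K_def)
    \<comment> \<open>One of the two generators is the last letter stripped off, the other is the
      next letter, which lengthens by maximality of \<open>k\<close>.\<close>
    have vst: "len (x k) \<le> len (x k \<otimes> s)" "len (x k) \<le> len (x k \<otimes> t)"
      using up down by (auto simp: x_Suc j split: if_splits)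
    have lt: "len (x k) < len w" using kK k1 by (simp add: K_def)
    have pos: "0 \<le> act (x k) (simple_root s) r" "0 \<le> act (x k) (simple_root t) r"
      using less.hyps[OF lt x sS vst(1)] less.hyps[OF lt x t(1) vst(2)] less.prems by auto
    have wx: "w = x k \<otimes> inv (val (altword t s k))"
      using w A[of k] by (simp add: x_def m_assoc)
    define c where "c = cox_c s t"
    define m where "m = cox_m W t s"
    have mst: "m = cox_m W s t" using ord_mult_commute sS t by (simp add: m_def)
    \<comment> \<open>If m letters could be stripped off, the dihedral factor removed would be the
      longest element. It also has a reduced word ending in s, so s would shorten
      \<open>w\<close>.\<close>
    have km: "m = 0 \<or> k < m"
    proof (rule ccontr)
      assume "\<not> (m = 0 \<or> k < m)"
      then have m: "0 < m" "m \<le> k" by auto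
      have "len (x m) + m = len w"
      proof -
        have "len w \<le> len (x m) + m" by (rule len_w)
        moreover have "len (x (m + i)) + i \<ge> len (x m)" for i
        proof (induction i)
          case (Suc i)
          show ?case
            using Suc len_mult_cases[OF x[of "m + i"], of "if even (m + i) then t else s"] sS t
            unfolding add_Suc_right x_Suc by auto
        qed simp
        from this[of "k - m"] have "len (x k) + (k - m) \<ge> len (x m)" using m by simp
        then have "len (x m) + m \<le> len w" using kK m by (simp add: K_def)
        ultimately show ?thesis by simp
      qed
      moreover have "w = x m \<otimes> inv (val (altword t s m))"
        using w A[of m] by (simp add: x_def m_assoc)
      then have "len (w \<otimes> s) < len (x m) + m"
        using len_mult_altword[OF t(1) sS x[of m] m_def[symmetric] m(1)] by simp
      ultimately show False using less.prems by simp
    qed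
    have nonneg: "cheb c n \<ge> 0" if "n \<le> Suc k" for n
    proof (rule cheb_nonneg)
      have "m \<noteq> 1" using cox_m_neq_1[OF sS t(1) st] mst by simp
      then show "c = 1 \<or> (\<exists>m\<ge>2. c = cos (pi / real m) \<and> n \<le> m)"
        using km that sS t mst by (cases "m = 0") (auto simp: c_def cox_c_eq intro!: exI[of _ m])
    qed
    have "act w (simple_root s) = act (x k) (act (inv (val (altword t s k))) (simple_root s))"
      using x A by (subst wx) (simp add: act_mult)
    also have "\<dots> = (if even k then lc (cheb c (Suc k)) (act (x k) (simple_root s)) (cheb c k) (act (x k) (simple_root t))
     else lc (cheb c k) (act (x k) (simple_root s)) (cheb c (Suc k)) (act (x k) (simple_root t)))"
      using act_inv_altword[OF sS t(1)] x by (simp add: act_lc c_def)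
    finally show ?thesis using pos nonneg[of k] nonneg[of "Suc k"]
      by (simp add: lc_apply)
  qed
qed

lemma refl_simple_same: "s \<in> S \<Longrightarrow> refl s (simple_root s) = (\<lambda>t. - simple_root s t)"
  by (rule ext) (simp add: refl_eq_lc lc_apply)

lemma act_uminus: "w \<in> carrier W \<Longrightarrow> act w (\<lambda>t. - x t) = (\<lambda>t. - act w x t)"
  using act_lc[of w "- 1" x 0 x] by (simp add: lc_def)

lemma act_mult_simple_same:
  assumes "w \<in> carrier W" "s \<in> S"
  shows "act (w \<otimes> s) (simple_root s) = (\<lambda>t. - act w (simple_root s) t)"
  using assms by (simp add: act_mult act_S refl_simple_same act_uminus)

lemma negative_root_if_descent:
  assumes "w \<in> carrier W" "s \<in> S" "len (w \<otimes> s) \<le> len w" "r \<in> S"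
  shows "act w (simple_root s) r \<le> 0"
  using positive_root_if_ascent[of "w \<otimes> s" s r] assms act_mult_simple_same[of w s] by simp

section \<open>Positive roots and inversions\<close>

abbreviation \<Phi> :: "('a \<Rightarrow> real) set" where "\<Phi> \<equiv> roots W S"
abbreviation \<Phi>p :: "('a \<Rightarrow> real) set" where "\<Phi>p \<equiv> positive_roots W S"

lemma root_cases:
  assumes "\<beta> \<in> \<Phi>"
  obtains w s where "w \<in> carrier W" "s \<in> S" "\<beta> = act w (simple_root s)"
  using assms by (auto simp: roots_def)

lemma act_root: 
  assumes "w \<in> carrier W" "\<beta> \<in> \<Phi>"
  shows "act w \<beta> \<in> \<Phi>"
proof -
  obtain v s where "v \<in> carrier W" "s \<in> S" "\<beta> = act v (simple_root s)"
    using assms by (blast elim: root_cases)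
  then show ?thesis using assms act_mult[of w v]
    unfolding roots_def by (intro CollectI exI[of _ "w \<otimes> v"] exI[of _ s]) simp
qed

lemma simple_root_root [simp]: "s \<in> S \<Longrightarrow> simple_root s \<in> \<Phi>"
  unfolding roots_def by (intro CollectI exI[of _ \<one>] exI[of _ s]) simp

lemma uminus_root: 
  assumes "\<beta> \<in> \<Phi>"
  shows "(\<lambda>t. - \<beta> t) \<in> \<Phi>"
proof -
  obtain v s where v: "v \<in> carrier W" "s \<in> S" "\<beta> = act v (simple_root s)"
    using assms by (blast elim: root_cases)
  then show ?thesis using act_mult_simple_same[of v s] act_root[of "v \<otimes> s" "simple_root s"] by simp
qed

lemma form_root_self: "\<beta> \<in> \<Phi> \<Longrightarrow> form \<beta> \<beta> = 1"
  by (erule root_cases) (simp add: form_act)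

lemma root_outside:
  assumes "\<beta> \<in> \<Phi>" "t \<notin> S"
  shows "\<beta> t = 0"
proof -
  obtain w s where w: "w \<in> carrier W" "s \<in> S" "\<beta> = act w (simple_root s)"
    using assms by (blast elim: root_cases)
  obtain ws where ws: "ws \<in> lists S" "val ws = w" using ex_word w by blast
  have "u \<in> lists S \<Longrightarrow> foldr refl u (simple_root s) t = 0" for u
    using assms w by (induction u) (auto simp: simple_reflection_def simple_root_def)
  then show ?thesis using ws w act_val[OF ws(1)] by simp
qed

lemma root_sign:
  assumes "\<beta> \<in> \<Phi>"
  shows "(\<forall>r\<in>S. 0 \<le> \<beta> r) \<or> (\<forall>r\<in>S. \<beta> r \<le> 0)"
proof -
  obtain w s where w: "w \<in> carrier W" "s \<in> S" "\<beta> = act w (simple_root s)"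
    using assms by (blast elim: root_cases)
  then show ?thesis
    using positive_root_if_ascent[of w s] negative_root_if_descent[of w s] nle_le by blast
qed

lemma root_nonzero:
  assumes "\<beta> \<in> \<Phi>"
  shows "\<exists>s\<in>S. \<beta> s \<noteq> 0"
proof (rule ccontr)
  assume "\<not> ?thesis"
  then have "form \<beta> \<beta> = 0" by (simp add: cox_form_def)
  then show False using form_root_self[OF assms] by simp
qed

lemma ht_root_nonzero:
  assumes "\<beta> \<in> \<Phi>"
  shows "ht \<beta> \<noteq> 0"
proof -
  obtain s where s: "s \<in> S" "\<beta> s \<noteq> 0" using root_nonzero assms by blast
  from root_sign[OF assms] show ?thesis
  proof
    assume p: "\<forall>r\<in>S. 0 \<le> \<beta> r"
    then have "\<beta> s > 0" using s by (metis order_le_less)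
    then have "ht \<beta> > 0" unfolding ht_def using p s finite_S by (intro sum_pos2[of S s]) auto
    then show ?thesis by simp
  next
    assume p: "\<forall>r\<in>S. \<beta> r \<le> 0"
    then have "- \<beta> s > 0" using s by force
    then have "(\<Sum>s\<in>S. - \<beta> s) > 0" using p s finite_S by (intro sum_pos2[of S s]) auto
    then show ?thesis by (simp add: ht_def sum_negf)
  qed
qed

lemma positive_root_iff: "\<beta> \<in> \<Phi>p \<longleftrightarrow> \<beta> \<in> \<Phi> \<and> ht \<beta> > 0"
proof -
  have "ht \<beta> \<ge> 0" if "\<forall>s\<in>S. 0 \<le> \<beta> s" using that by (auto simp: ht_def intro: sum_nonneg)
  moreover have "ht \<beta> \<le> 0" if "\<forall>s\<in>S. \<beta> s \<le> 0" using that by (auto simp: ht_def intro: sum_nonpos)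
  ultimately show ?thesis
    using root_sign[of \<beta>] ht_root_nonzero[of \<beta>] by (auto simp: positive_roots_def)
qed

lemma \<Phi>p_root [dest]: "\<beta> \<in> \<Phi>p \<Longrightarrow> \<beta> \<in> \<Phi>"
  by (simp add: positive_roots_def)

lemma ht_uminus: "ht (\<lambda>t. - x t) = - ht x"
  by (simp add: ht_def sum_negf)

lemma not_positive_root: "\<beta> \<in> \<Phi> \<Longrightarrow> \<not> ht \<beta> > 0 \<Longrightarrow> ht \<beta> < 0"
  using ht_root_nonzero[of \<beta>] by linarith

lemma ht_act_pos_or_neg:
  "\<lbrakk>w \<in> carrier W; \<beta> \<in> \<Phi>\<rbrakk> \<Longrightarrow> ht (act w \<beta>) > 0 \<or> ht (act w \<beta>) < 0"
  using ht_root_nonzero[OF act_root] by (metis linorder_neqE)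

lemma ht_simple [simp]: "s \<in> S \<Longrightarrow> ht (simple_root s) = 1"
  using finite_S by (simp add: ht_def simple_root_def)

lemma simple_root_positive [simp]: "s \<in> S \<Longrightarrow> simple_root s \<in> \<Phi>p"
  by (simp add: positive_root_iff)

lemma ht_act_simple_pos_iff:
  assumes "w \<in> carrier W" "s \<in> S"
  shows "ht (act w (simple_root s)) > 0 \<longleftrightarrow> len w < len (w \<otimes> s)"
proof -
  let ?\<beta> = "act w (simple_root s)"
  have \<beta>: "?\<beta> \<in> \<Phi>" using act_root assms by simp
  show ?thesis
  proof (cases "len w < len (w \<otimes> s)")
    case True
    then have "ht ?\<beta> \<ge> 0"
      unfolding ht_def using assms by (intro sum_nonneg positive_root_if_ascent) auto
    then show ?thesis using True ht_root_nonzero[OF \<beta>] by simp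
  next
    case False
    then have "ht ?\<beta> \<le> 0"
      unfolding ht_def using assms by (intro sum_nonpos negative_root_if_descent) auto
    then show ?thesis using False by simp
  qed
qed

lemma ht_act_simple_neg_iff:
  assumes "w \<in> carrier W" "s \<in> S"
  shows "ht (act w (simple_root s)) < 0 \<longleftrightarrow> len (w \<otimes> s) < len w"
  using ht_act_simple_pos_iff[OF assms] ht_act_pos_or_neg[OF assms(1), of "simple_root s"]
    len_mult_neq[OF assms] assms by fastforce

lemma positive_root_coeff_nonneg: "\<beta> \<in> \<Phi>p \<Longrightarrow> s \<in> S \<Longrightarrow> \<beta> s \<ge> 0"
  by (simp add: positive_roots_def)

text \<open>Some coefficient of \<beta> at a t other than s is positive: otherwise \<beta> is a
  multiple of \<alpha>_s, and \<langle>\<beta>, \<beta>\<rangle> = 1 forces \<beta> = \<alpha>_s.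
  The reflection leaves this coefficient alone, and one positive coefficient decides the sign of a
  root.\<close>

lemma refl_positive:
  assumes "\<beta> \<in> \<Phi>p" "s \<in> S" "\<beta> \<noteq> simple_root s"
  shows "refl s \<beta> \<in> \<Phi>p"
proof -
  have \<beta>: "\<beta> \<in> \<Phi>" using assms by blast
  have r: "refl s \<beta> \<in> \<Phi>" using act_root[of s \<beta>] \<beta> assms by (simp add: act_S)
  have "\<exists>t\<in>S. t \<noteq> s \<and> \<beta> t \<noteq> 0"
  proof (rule ccontr)
    assume *: "\<not> ?thesis"
    have "\<beta> = lc (\<beta> s) (simple_root s) 0 \<beta>"
      using * root_outside[OF \<beta>] by (auto simp: lc_apply simple_root_def fun_eq_iff)
    then have "form \<beta> \<beta> = form (lc (\<beta> s) (simple_root s) 0 \<beta>) (lc (\<beta> s) (simple_root s) 0 \<beta>)"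
      by simp
    then have "(\<beta> s)\<^sup>2 = 1"
      using form_root_self[OF \<beta>] assms by (simp add: form_lc power2_eq_square)
    moreover have "\<beta> s \<ge> 0" using assms positive_root_coeff_nonneg by blast
    ultimately have "\<beta> s = 1" by (simp add: power2_eq_1_iff)
    then have "\<beta> = simple_root s"
      using * root_outside[OF \<beta>] by (auto simp: simple_root_def fun_eq_iff)
    then show False using assms by blast
  qed
  then obtain t where t: "t \<in> S" "t \<noteq> s" "\<beta> t \<noteq> 0" by blast
  then have "\<beta> t > 0" using positive_root_coeff_nonneg assms by (metis order_le_less)
  moreover have "refl s \<beta> t = \<beta> t" using t by (simp add: simple_reflection_def simple_root_def)
  ultimately have "\<not> (\<forall>t\<in>S. refl s \<beta> t \<le> 0)" using t by force
  then have "\<forall>t\<in>S. 0 \<le> refl s \<beta> t" using root_sign[OF r] by blast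
  then show ?thesis using r by (simp add: positive_roots_def)
qed

text \<open>A further letter s on the right adds at most one inversion, since s permutes the
  positive roots other than \<alpha>_s.\<close>

lemma finite_inversions:
  assumes "w \<in> carrier W"
  shows "finite {\<beta> \<in> \<Phi>p. ht (act w \<beta>) < 0}"
proof -
  have "ws \<in> lists S \<Longrightarrow> finite {\<beta> \<in> \<Phi>p. ht (act (val ws) \<beta>) < 0}" for ws
  proof (induction ws rule: rev_induct)
    case Nil
    have "{\<beta> \<in> \<Phi>p. ht (act \<one> \<beta>) < 0} = {}" by (auto simp: positive_root_iff)
    then show ?case by (metis val_Nil finite.emptyI)
  next
    case (snoc s ws)
    let ?A = "{\<beta> \<in> \<Phi>p. ht (act (val ws) \<beta>) < 0}"
    have s: "s \<in> S" and ws: "ws \<in> lists S" using snoc by auto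
    have "{\<beta> \<in> \<Phi>p. ht (act (val (ws @ [s])) \<beta>) < 0} \<subseteq> insert (simple_root s) (refl s ` ?A)"
    proof
      fix \<beta> assume "\<beta> \<in> {\<beta> \<in> \<Phi>p. ht (act (val (ws @ [s])) \<beta>) < 0}"
      then have \<beta>: "\<beta> \<in> \<Phi>p" "ht (act (val ws) (refl s \<beta>)) < 0"
        using s ws by (auto simp: act_mult act_S in_listsI)
      show "\<beta> \<in> insert (simple_root s) (refl s ` ?A)"
      proof (cases "\<beta> = simple_root s")
        case False
        then have "refl s \<beta> \<in> ?A" using refl_positive \<beta> s by blast
        moreover have "\<beta> = refl s (refl s \<beta>)" using s by simp
        ultimately show ?thesis by blast
      qed simp
    qed
    moreover have "finite ?A" using snoc ws by blast
    ultimately show ?case using finite_subset by blast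
  qed
  then show ?thesis using assms ex_word by metis
qed

lemma ex_reflection:
  assumes "\<beta> \<in> \<Phi>"
  obtains r where "r \<in> carrier W" "\<And>x. act r x = lc 1 x (- 2 * form x \<beta>) \<beta>"
proof -
  obtain w s where w: "w \<in> carrier W" "s \<in> S" "\<beta> = act w (simple_root s)"
    using assms by (blast elim: root_cases)
  have "act (w \<otimes> s \<otimes> inv w) x = lc 1 x (- 2 * form x \<beta>) \<beta>" for x
  proof -
    have "act (w \<otimes> s \<otimes> inv w) x = act w (refl s (act (inv w) x))"
      using w by (simp add: act_mult act_S)
    also have "\<dots> = lc 1 x (- 2 * form (act (inv w) x) (simple_root s)) \<beta>"
      using w by (simp add: refl_eq_lc act_lc)
    also have "form (act (inv w) x) (simple_root s) = form x \<beta>"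
      using w form_act_left[of "inv w" x] by simp
    finally show ?thesis .
  qed
  then show ?thesis using that[of "w \<otimes> s \<otimes> inv w"] w by simp
qed

lemma ex_inverting:
  assumes "\<beta> \<in> \<Phi>"
  obtains w where "w \<in> carrier W" "ht (act w \<beta>) < 0"
proof -
  obtain w s where w: "w \<in> carrier W" "s \<in> S" "\<beta> = act w (simple_root s)"
    using assms by (blast elim: root_cases)
  have "act (s \<otimes> inv w) \<beta> = refl s (simple_root s)" using w by (simp add: act_mult act_S)
  then show ?thesis using that[of "s \<otimes> inv w"] w by (simp add: refl_simple_same ht_uminus)
qed

text \<open>The last letter of a shortest word inverting a positive root leads down in the root poset.\<close>

lemma root_down:
  assumes "\<beta> \<in> \<Phi>p" "w \<in> carrier W" "ht (act w \<beta>) < 0"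
    and min: "\<And>v. v \<in> carrier W \<Longrightarrow> ht (act v \<beta>) < 0 \<Longrightarrow> len w \<le> len v"
  obtains s v where "s \<in> S" "v \<in> carrier W" "len v < len w" "form \<beta> (simple_root s) > 0"
    "ht (act v (refl s \<beta>)) < 0"
proof -
  have "w \<noteq> \<one>" using assms by (auto simp: positive_root_iff)
  then obtain s where s: "s \<in> S" "len w = len (w \<otimes> s) + 1" using ex_right_descent assms by blast
  define v where "v = w \<otimes> s"
  have v: "v \<in> carrier W" "len v < len w" "w = v \<otimes> s" using s assms by (auto simp: v_def)
  have "\<not> ht (act v \<beta>) < 0" using min[OF v(1)] v(2) by auto
  then have "ht (act v \<beta>) > 0" using ht_act_pos_or_neg[OF v(1)] assms by blast
  moreover have "ht (act v (simple_root s)) > 0"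
    using ht_act_simple_pos_iff[OF v(1) s(1)] v by simp
  moreover have neg: "ht (act v (refl s \<beta>)) < 0" using assms v s by (simp add: act_mult act_S)
  then have "ht (act v \<beta>) - 2 * form \<beta> (simple_root s) * ht (act v (simple_root s)) < 0"
    using v by (simp add: refl_eq_lc act_lc ht_lc)
  ultimately have "form \<beta> (simple_root s) > 0"
    by (smt (verit) mult_nonneg_nonneg mult_minus_left)
  then show ?thesis using that s v neg by blast
qed

end

text \<open>
  The ratio of consecutive terms drops by at least \<open>2 - 2c\<close> in each step, since
  \<open>q + 1 / q \<ge> 2\<close>.
\<close>

lemma recurrence_nonpos:
  fixes c :: real
  assumes "c < 1"
  shows "\<exists>N. \<forall>h :: nat \<Rightarrow> real. (\<forall>n. h (Suc (Suc n)) = 2 * c * h (Suc n) - h n) \<longrightarrow> (\<exists>k\<le>N. h k \<le> 0)"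
proof -
  define d where "d = 2 - 2 * c"
  have d: "d > 0" using assms by (simp add: d_def)
  obtain M where M: "2 * c < real M * d" using reals_Archimedean3[OF d] by blast
  have "\<exists>k\<le>M + 2. h k \<le> 0" if h: "\<forall>n. h (Suc (Suc n)) = 2 * c * h (Suc n) - h n" for h :: "nat \<Rightarrow> real"
  proof (rule ccontr)
    assume "\<not> ?thesis"
    then have pos: "h k > 0" if "k \<le> M + 2" for k using that by force
    define q where "q n = h (Suc n) / h n" for n
    have qpos: "q n > 0" if "n \<le> Suc M" for n
      using pos[of n] pos[of "Suc n"] that by (simp add: q_def)
    have qS: "q (Suc n) = 2 * c - 1 / q n" if "n \<le> Suc M" for n
      using pos[of n] pos[of "Suc n"] that h by (simp add: q_def field_simps)
    have "n \<le> M \<Longrightarrow> q (Suc n) \<le> 2 * c - real n * d" for n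
    proof (induction n)
      case 0
      show ?case using qS[of 0] qpos[of 0] by simp
    next
      case (Suc n)
      define x where "x = q (Suc n)"
      have x: "x > 0" using qpos[of "Suc n"] Suc by (simp add: x_def)
      have "0 \<le> (x - 1)\<^sup>2 / x" using x by simp
      also have "\<dots> = x + 1 / x - 2" using x by (simp add: power2_eq_square field_simps)
      finally have "2 * c - 1 / x \<le> x - d" by (simp add: d_def)
      then show ?case using qS[of "Suc n"] Suc by (simp add: x_def algebra_simps)
    qed
    from this[of M] show False using M qpos[of "Suc M"] by simp
  qed
  then show ?thesis by blast
qed

text \<open>For roots x and y with inner product c this is a string of roots of the dihedral group
  generated by their reflections: each new term is the last but one, reflected in the last and
  negated. Consecutive inner products remain c.\<close>

fun root_seq :: "real \<Rightarrow> ('a \<Rightarrow> real) \<Rightarrow> ('a \<Rightarrow> real) \<Rightarrow> nat \<Rightarrow> 'a \<Rightarrow> real" where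
  "root_seq c x y 0 = y"
| "root_seq c x y (Suc 0) = x"
| "root_seq c x y (Suc (Suc n)) = lc (2 * c) (root_seq c x y (Suc n)) (- 1) (root_seq c x y n)"

context finite_coxeter_system
begin

section \<open>Dominance of roots\<close>

text \<open>The dominance relation of Brink and Howlett, stated for arbitrary vectors so that a
  group element can be applied to both sides without keeping track of signs.\<close>

definition dominates :: "('a \<Rightarrow> real) \<Rightarrow> ('a \<Rightarrow> real) \<Rightarrow> bool" where
  "dominates x y \<longleftrightarrow> (\<forall>w\<in>carrier W. ht (act w x) < 0 \<longrightarrow> ht (act w y) < 0)"

lemma dominatesD: "\<lbrakk>dominates x y; w \<in> carrier W; ht (act w x) < 0\<rbrakk> \<Longrightarrow> ht (act w y) < 0"
  by (simp add: dominates_def)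

lemma dominates_trans: "\<lbrakk>dominates x y; dominates y z\<rbrakk> \<Longrightarrow> dominates x z"
  by (simp add: dominates_def)

lemma dominates_act:
  assumes "dominates x y" "v \<in> carrier W"
  shows "dominates (act v x) (act v y)"
  unfolding dominates_def
proof (intro ballI impI)
  fix w assume "w \<in> carrier W" "ht (act w (act v x)) < 0"
  then show "ht (act w (act v y)) < 0"
    using dominatesD[OF assms(1), of "w \<otimes> v"] assms by (simp add: act_mult)
qed

lemma neg_reflection_root:
  assumes "x \<in> \<Phi>" "y \<in> \<Phi>"
  shows "lc (2 * form x y) x (- 1) y \<in> \<Phi>"
proof -
  obtain r where r: "r \<in> carrier W" "\<And>z. act r z = lc 1 z (- 2 * form z x) x"
    using ex_reflection assms by blast
  have "lc (2 * form x y) x (- 1) y = (\<lambda>t. - act r y t)"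
    by (simp add: r(2) lc_def form_commute algebra_simps)
  then show ?thesis using uminus_root act_root r assms by metis
qed

lemma root_seq_root:
  assumes "x \<in> \<Phi>" "y \<in> \<Phi>"
  defines "u \<equiv> root_seq (form x y) x y"
  shows "u n \<in> \<Phi> \<and> u (Suc n) \<in> \<Phi> \<and> form (u (Suc n)) (u n) = form x y"
proof (induction n)
  case 0
  show ?case using assms by (simp add: u_def)
next
  case (Suc n)
  have "u (Suc (Suc n)) = lc (2 * form (u (Suc n)) (u n)) (u (Suc n)) (- 1) (u n)"
    using Suc by (simp add: u_def)
  then show ?case using Suc neg_reflection_root[of "u (Suc n)" "u n"]
    by (simp add: form_lc form_root_self form_commute[of "u n"])
qed

lemma ht_act_root_seq:
  "w \<in> carrier W \<Longrightarrow> ht (act w (root_seq c x y (Suc (Suc n))))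
    = 2 * c * ht (act w (root_seq c x y (Suc n))) - ht (act w (root_seq c x y n))"
  by (simp add: act_lc ht_lc)

text \<open>If the inner product were below 1, dominance would propagate along the string of
  \<open>x\<close> and \<open>y\<close> and keep all its roots positive, against
  \<open>recurrence_nonpos\<close>.\<close>

lemma form_ge_1_if_dominates:
  assumes "x \<in> \<Phi>p" "y \<in> \<Phi>p" "dominates x y"
  shows "form x y \<ge> 1"
proof (rule ccontr)
  define c where "c = form x y"
  define u where "u = root_seq c x y"
  assume "\<not> form x y \<ge> 1"
  then have c: "c < 1" by (simp add: c_def)
  have u: "u n \<in> \<Phi> \<and> u (Suc n) \<in> \<Phi> \<and> form (u (Suc n)) (u n) = c" for n
    using root_seq_root[of x y n] assms by (auto simp: u_def c_def)
  have step: "u (Suc (Suc n)) = lc (2 * c) (u (Suc n)) (- 1) (u n)" for n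
    by (simp add: u_def)
  have dom: "dominates (u (Suc n)) (u n)" for n
  proof (induction n)
    case 0
    then show ?case using assms by (simp add: u_def)
  next
    case (Suc n)
    \<comment> \<open>The reflection in \<open>u (Suc n)\<close> negates this root and sends
      \<open>u n\<close> to the negative of the next root. Contraposition turns the dominance in one
      pair into that in the next.\<close>
    obtain r where r: "r \<in> carrier W" "\<And>z. act r z = lc 1 z (- 2 * form z (u (Suc n))) (u (Suc n))"
      using ex_reflection u by blast
    have r1: "act r (u (Suc n)) = (\<lambda>t. - u (Suc n) t)"
      using u by (simp add: r(2) form_root_self lc_def)
    have r2: "act r (u n) = (\<lambda>t. - u (Suc (Suc n)) t)"
      using u by (simp add: r(2) step lc_def form_commute[of "u n"] algebra_simps)
    show ?case unfolding dominates_def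
    proof (intro ballI impI)
      fix w assume w: "w \<in> carrier W" and neg: "ht (act w (u (Suc (Suc n)))) < 0"
      have "ht (act (w \<otimes> r) (u n)) > 0"
        using w r(1) neg by (simp add: act_mult r2 act_uminus ht_uminus)
      then have "\<not> ht (act (w \<otimes> r) (u (Suc n))) < 0"
        using dominatesD[OF Suc, of "w \<otimes> r"] w r by auto
      then have "\<not> ht (act w (u (Suc n))) > 0"
        using w r(1) by (simp add: act_mult r1 act_uminus ht_uminus)
      then show "ht (act w (u (Suc n))) < 0" using ht_act_pos_or_neg[OF w] u by blast
    qed
  qed
  have pos: "ht (u n) > 0" for n
  proof (induction n)
    case 0
    then show ?case using assms by (simp add: u_def positive_root_iff)
  next
    case (Suc n)
    then show ?case using dominatesD[OF dom[of n], of \<one>] not_positive_root[of "u (Suc n)"] u[of n]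
      by fastforce
  qed
  obtain N where "\<forall>h :: nat \<Rightarrow> real. (\<forall>n. h (Suc (Suc n)) = 2 * c * h (Suc n) - h n) \<longrightarrow> (\<exists>k\<le>N. h k \<le> 0)"
    using recurrence_nonpos[OF c] by blast
  then have "\<exists>k\<le>N. ht (u k) \<le> 0" by (simp add: step ht_lc)
  then show False using pos by (meson not_le)
qed

text \<open>Suppose that w inverts x but not y. The heights along the string y, x, ... never
  decrease, so all its roots are positive, while the heights of their images under w strictly
  decrease and are negative from x on. Thus w would have infinitely many inversions.\<close>

lemma dominates_if_form_ge_1_ht_le:
  assumes "x \<in> \<Phi>p" "y \<in> \<Phi>p" "form x y \<ge> 1" "ht y \<le> ht x"
  shows "dominates x y"
  unfolding dominates_def
proof (intro ballI impI, rule ccontr)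
  fix w assume w: "w \<in> carrier W" and neg: "ht (act w x) < 0" and "\<not> ht (act w y) < 0"
  then have wy: "ht (act w y) \<ge> 0" by simp
  define c where "c = form x y"
  define u where "u = root_seq c x y"
  have u: "u n \<in> \<Phi>" for n
    using root_seq_root[of x y n] assms by (auto simp: u_def c_def)
  have step: "ht (act v (u (Suc (Suc n)))) = 2 * c * ht (act v (u (Suc n))) - ht (act v (u n))"
    if "v \<in> carrier W" for v n
    using that unfolding u_def by (rule ht_act_root_seq)
  have c: "c \<ge> 1" using assms by (simp add: c_def)
  have "ht (u n) > 0 \<and> ht (u n) \<le> ht (u (Suc n))" for n
  proof (induction n)
    case 0
    then show ?case using assms by (simp add: u_def positive_root_iff)
  next
    case (Suc n)
    have "c * ht (u (Suc n)) \<ge> 1 * ht (u (Suc n))" using c Suc by (intro mult_right_mono) auto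
    moreover have "ht (u (Suc (Suc n))) = 2 * c * ht (u (Suc n)) - ht (u n)"
      using step[of \<one> n] by simp
    ultimately show ?case using Suc by linarith
  qed
  then have pos: "u n \<in> \<Phi>p" for n using u by (simp add: positive_root_iff)
  have dec: "ht (act w (u (Suc n))) < 0 \<and> ht (act w (u (Suc n))) < ht (act w (u n))" for n
  proof (induction n)
    case 0
    then show ?case using neg wy by (simp add: u_def)
  next
    case (Suc n)
    have "c * ht (act w (u (Suc n))) \<le> 1 * ht (act w (u (Suc n)))"
      using c Suc by (intro mult_right_mono_neg) auto
    then show ?case using step[OF w, of n] Suc by linarith
  qed
  have "strict_mono (\<lambda>n. - ht (act w (u n)))" using dec by (simp add: strict_mono_Suc_iff)
  then have "inj (\<lambda>n. - ht (act w (u n)))" by (rule strict_mono_imp_inj_on)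
  then have "inj u" unfolding inj_def by metis
  then have "inj (\<lambda>n. u (Suc n))" unfolding inj_def by blast
  then have "infinite (range (\<lambda>n. u (Suc n)))" using finite_imageD by blast
  moreover have "range (\<lambda>n. u (Suc n)) \<subseteq> {\<beta> \<in> \<Phi>p. ht (act w \<beta>) < 0}" using pos dec by blast
  ultimately show False using finite_inversions[OF w] finite_subset by blast
qed

lemma dominates_if_form_ge_1:
  assumes "x \<in> \<Phi>p" "y \<in> \<Phi>p" "form x y \<ge> 1"
  shows "dominates x y \<or> dominates y x"
  using dominates_if_form_ge_1_ht_le[of x y] dominates_if_form_ge_1_ht_le[of y x] assms
    form_commute[of y x] linear[of "ht x" "ht y"] by metis

text \<open>The reflection s makes \<alpha>_s negative and no other positive root, so \<alpha>_s
  dominates no other positive root. This leaves one of the two directions that an inner product of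
  at least 1 allows.\<close>

lemma dominates_simple_iff:
  assumes "\<beta> \<in> \<Phi>p" "s \<in> S" "\<beta> \<noteq> simple_root s"
  shows "dominates \<beta> (simple_root s) \<longleftrightarrow> form \<beta> (simple_root s) \<ge> 1"
    and "\<not> dominates (simple_root s) \<beta>"
proof -
  show n: "\<not> dominates (simple_root s) \<beta>"
  proof
    assume "dominates (simple_root s) \<beta>"
    then have "ht (act s \<beta>) < 0"
      by (rule dominatesD) (use assms in \<open>auto simp: act_S refl_simple_same ht_uminus\<close>)
    then show False using refl_positive[OF assms] assms by (simp add: act_S positive_root_iff)
  qed
  show "dominates \<beta> (simple_root s) \<longleftrightarrow> form \<beta> (simple_root s) \<ge> 1"
    using n dominates_if_form_ge_1[of \<beta> "simple_root s"] form_ge_1_if_dominates[of \<beta> "simple_root s"] assms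
    by auto
qed

text \<open>Some group element makes \<open>x\<close> simple. Dominance keeps the image of
  \<open>y\<close> positive, and a simple root dominates no other positive root.\<close>

lemma dominates_antisym:
  assumes "x \<in> \<Phi>p" "y \<in> \<Phi>p" "dominates x y" "dominates y x"
  shows "x = y"
proof -
  obtain w s where w: "w \<in> carrier W" "s \<in> S" "x = act w (simple_root s)"
    using assms by (blast elim: root_cases)
  let ?y = "act (inv w) y"
  have x: "act (inv w) x = simple_root s" using w by simp
  have y: "?y \<in> \<Phi>" using act_root[of "inv w" y] w assms by blast
  have "\<not> ht ?y < 0" using dominatesD[OF assms(4), of "inv w"] w x by auto
  then have "?y \<in> \<Phi>p" using y not_positive_root[OF y] positive_root_iff by blast
  moreover have "dominates (simple_root s) ?y" using dominates_act[OF assms(3), of "inv w"] w x by simp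
  ultimately have "?y = simple_root s" using dominates_simple_iff(2) w by blast
  then have "act w ?y = x" using w by simp
  then show ?thesis using w by simp
qed

section \<open>Inner products of roots spanning a positive definite plane\<close>

definition lin :: "(('a \<Rightarrow> real) \<Rightarrow> real) \<Rightarrow> bool" where
  "lin f \<longleftrightarrow> (\<forall>a x b y. f (lc a x b y) = a * f x + b * f y)"

lemma linD: "lin f \<Longrightarrow> f (lc a x b y) = a * f x + b * f y"
  by (simp add: lin_def)

lemma lin_act: "\<lbrakk>lin f; v \<in> carrier W\<rbrakk> \<Longrightarrow> lin (\<lambda>x. f (act v x))"
  by (simp add: lin_def act_lc)

lemma lin_uminus: "lin f \<Longrightarrow> f (\<lambda>t. - x t) = - f x"
  using linD[of f "- 1" x 0 x] by (simp add: lc_def)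

lemma lin_expand:
  assumes "lin f" "\<And>t. t \<notin> S \<Longrightarrow> x t = 0"
  shows "f x = (\<Sum>s\<in>S. x s * f (simple_root s))"
proof -
  have "finite F \<Longrightarrow> (\<And>t. t \<notin> F \<Longrightarrow> x t = 0) \<Longrightarrow> f x = (\<Sum>s\<in>F. x s * f (simple_root s))" for F x
  proof (induction F arbitrary: x rule: finite_induct)
    case empty
    then have "x = lc 0 x 0 x" by (auto simp: lc_def)
    then have "f x = 0 * f x + 0 * f x" using linD[OF assms(1)] by metis
    then show ?case by simp
  next
    case (insert s F)
    let ?y = "\<lambda>t. if t = s then 0 else x t"
    have x: "x = lc (x s) (simple_root s) 1 ?y" by (auto simp: lc_def simple_root_def)
    have "f x = x s * f (simple_root s) + f ?y" by (subst x) (simp add: linD[OF assms(1)])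
    also have "f ?y = (\<Sum>t\<in>F. ?y t * f (simple_root t))" using insert.prems by (intro insert.IH) auto
    also have "\<dots> = (\<Sum>t\<in>F. x t * f (simple_root t))" using insert.hyps by (intro sum.cong) auto
    finally show ?case using insert.hyps by simp
  qed
  then show ?thesis using finite_S assms by blast
qed

text \<open>The finiteness assumption puts f into the Tits cone. Choose v so that f composed with v
  is negative at the fewest positive roots: if f (v \<alpha>_s) < 0, then passing to vs removes
  \<alpha>_s from these roots and permutes the others by s.\<close>

lemma ex_chamber:
  assumes f: "lin f" and fin: "finite {\<gamma> \<in> \<Phi>p. f \<gamma> < 0}"
  obtains v where "v \<in> carrier W" "\<And>s. s \<in> S \<Longrightarrow> f (act v (simple_root s)) \<ge> 0"
proof -
  define A where "A v = {\<gamma> \<in> \<Phi>p. f (act v \<gamma>) < 0}" for v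
  have finA: "finite (A v)" if v: "v \<in> carrier W" for v
  proof -
    have "A v \<subseteq> {\<beta> \<in> \<Phi>p. ht (act v \<beta>) < 0} \<union> act (inv v) ` {\<gamma> \<in> \<Phi>p. f \<gamma> < 0}"
    proof
      fix \<gamma> assume \<gamma>: "\<gamma> \<in> A v"
      show "\<gamma> \<in> {\<beta> \<in> \<Phi>p. ht (act v \<beta>) < 0} \<union> act (inv v) ` {\<gamma> \<in> \<Phi>p. f \<gamma> < 0}"
      proof (cases "ht (act v \<gamma>) < 0")
        case False
        then have "act v \<gamma> \<in> \<Phi>p"
          using \<gamma> ht_act_pos_or_neg[OF v] act_root[OF v] by (auto simp: A_def positive_root_iff)
        moreover have "\<gamma> = act (inv v) (act v \<gamma>)" using v by simp
        ultimately show ?thesis using \<gamma> by (auto simp: A_def)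
      qed (use \<gamma> in \<open>auto simp: A_def\<close>)
    qed
    then show ?thesis using finite_inversions[OF v] fin finite_subset by blast
  qed
  obtain v where v: "v \<in> carrier W" and min: "\<And>u. u \<in> carrier W \<Longrightarrow> card (A v) \<le> card (A u)"
    using ex_has_least_nat[of "\<lambda>v. v \<in> carrier W" \<one> "\<lambda>v. card (A v)"] by auto
  have "f (act v (simple_root s)) \<ge> 0" if s: "s \<in> S" for s
  proof (rule ccontr)
    assume neg: "\<not> ?thesis"
    have vs: "v \<otimes> s \<in> carrier W" using v s by simp
    have "refl s ` A (v \<otimes> s) \<subseteq> A v - {simple_root s}"
    proof
      fix \<delta> assume "\<delta> \<in> refl s ` A (v \<otimes> s)"
      then obtain \<gamma> where \<gamma>: "\<delta> = refl s \<gamma>" "\<gamma> \<in> \<Phi>p" "f (act v (refl s \<gamma>)) < 0"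
        using v s by (auto simp: A_def act_mult act_S)
      have "\<gamma> \<noteq> simple_root s"
      proof
        assume "\<gamma> = simple_root s"
        then have "f (act v (refl s \<gamma>)) = - f (act v (simple_root s))"
          using s v by (simp add: refl_simple_same act_uminus lin_uminus[OF f])
        then show False using \<gamma> neg by simp
      qed
      then have d: "\<delta> \<in> \<Phi>p" using refl_positive \<gamma> s by blast
      have "\<delta> \<noteq> simple_root s"
      proof
        assume "\<delta> = simple_root s"
        then have "\<gamma> = refl s (simple_root s)" using \<gamma> s by (metis refl_refl)
        then show False using \<gamma> s by (simp add: positive_root_iff refl_simple_same ht_uminus)
      qed
      then show "\<delta> \<in> A v - {simple_root s}" using d \<gamma> by (auto simp: A_def)
    qed
    then have "card (refl s ` A (v \<otimes> s)) \<le> card (A v - {simple_root s})"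
      using finA[OF v] by (intro card_mono) auto
    also have "\<dots> < card (A v)"
      by (rule card_Diff1_less[OF finA[OF v]]) (use neg s in \<open>simp add: A_def\<close>)
    also have "card (refl s ` A (v \<otimes> s)) = card (A (v \<otimes> s))"
      using s by (intro card_image inj_on_inverseI[of _ "refl s"]) auto
    finally show False using min[OF vs] by simp
  qed
  then show ?thesis using that v by blast
qed

text \<open>
  The functional below is the height of the component orthogonal to the plane. The rotation of
  the plane turns the other component of a root until its height is not positive, so a root at
  which the functional is not positive is an inversion of one of finitely many powers of the rotation.
\<close>

lemma ex_plane_functional:
  assumes x: "x \<in> \<Phi>" and y: "y \<in> \<Phi>" and c: "\<bar>form x y\<bar> < 1"
  obtains f where "lin f" "f x = 0" "f y = 0" "finite {\<gamma> \<in> \<Phi>p. f \<gamma> \<le> 0}"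
proof -
  define c where "c = form x y"
  define d where "d = 1 - c\<^sup>2"
  have "c\<^sup>2 < 1" using c by (simp add: c_def abs_square_less_1)
  then have d: "d > 0" by (simp add: d_def)
  have f: "form x x = 1" "form y y = 1" "form x y = c" "form y x = c"
    using x y by (simp_all add: form_root_self c_def form_commute)
  define a where "a z = (form z x - c * form z y) / d" for z
  define b where "b z = (form z y - c * form z x) / d" for z
  define pr where "pr z = lc (a z) x (b z) y" for z
  define orth where "orth z = lc 1 z (- 1) (pr z)" for z
  define g where "g z = ht z - a z * ht x - b z * ht y" for z
  have g_orth: "g z = ht (orth z)" for z by (simp add: g_def orth_def pr_def ht_lc)
  have ab: "a x = 1" "b x = 0" "a y = 0" "b y = 1"
    using d by (simp_all add: a_def b_def f d_def power2_eq_square)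
  have lin: "lin g"
    unfolding lin_def g_def a_def b_def by (simp add: ht_lc form_lc algebra_simps add_divide_distrib diff_divide_distrib)
  have g0: "g x = 0" "g y = 0" by (simp_all add: g_def ab)
  have o: "form (orth z) x = 0" "form (orth z) y = 0" for z
  proof -
    have ad: "a z * d = form z x - c * form z y" "b z * d = form z y - c * form z x"
      using d by (simp_all add: a_def b_def)
    have "a z * d + c * (b z * d) = d * form z x" "b z * d + c * (a z * d) = d * form z y"
      unfolding ad by (simp_all add: d_def algebra_simps power2_eq_square)
    then have "d * (a z + c * b z) = d * form z x" "d * (b z + c * a z) = d * form z y"
      by (simp_all add: algebra_simps)
    then have "a z + c * b z = form z x" "b z + c * a z = form z y" using d by simp_all
    then show "form (orth z) x = 0" "form (orth z) y = 0"
      by (simp_all add: orth_def pr_def form_lc f algebra_simps)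
  qed
  obtain r1 where r1: "r1 \<in> carrier W" "\<And>z. act r1 z = lc 1 z (- 2 * form z x) x"
    using ex_reflection x by blast
  obtain r2 where r2: "r2 \<in> carrier W" "\<And>z. act r2 z = lc 1 z (- 2 * form z y) y"
    using ex_reflection y by blast
  define \<rho> where "\<rho> = r1 \<otimes> r2"
  have \<rho>: "\<rho> \<in> carrier W" using r1 r2 by (simp add: \<rho>_def)
  have act\<rho>: "act \<rho> z = act r1 (act r2 z)" for z using r1 r2 by (simp add: \<rho>_def act_mult)
  have \<rho>k: "\<rho> [^] (k :: nat) \<in> carrier W" for k using \<rho> by simp
  have fix_orth: "act (\<rho> [^] (k :: nat)) (orth z) = orth z" for k z
  proof (induction k)
    case (Suc k)
    have "act \<rho> (orth z) = orth z" unfolding act\<rho> by (simp add: r1(2) r2(2) o lc_def)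
    then show ?case using Suc \<rho> by (simp add: act_mult)
  qed simp
  \<comment> \<open>If c = cos \<theta>, the product of the two reflections rotates the plane by
    twice \<theta>, and \<open>C\<close> is the cosine of that angle. It satisfies X^2 - 2CX + 1 = 0
    on the plane, which gives the recurrence.\<close>
  define C where "C = 2 * c\<^sup>2 - 1"
  have C: "C < 1" using \<open>c\<^sup>2 < 1\<close> by (simp add: C_def)
  have \<rho>plane: "act \<rho> (lc p x q y) = lc (p * (4 * c\<^sup>2 - 1) + 2 * c * q) x (- 2 * c * p - q) y" for p q
    unfolding act\<rho> r1(2) r2(2)
    by (rule ext) (simp add: form_lc f lc_apply power2_eq_square algebra_simps)
  have \<rho>2: "act \<rho> (act \<rho> (pr z)) = lc (2 * C) (act \<rho> (pr z)) (- 1) (pr z)" for z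
    unfolding pr_def \<rho>plane
    by (rule ext) (simp add: lc_apply C_def power2_eq_square algebra_simps)
  have rec: "ht (act (\<rho> [^] Suc (Suc k)) (pr z))
      = 2 * C * ht (act (\<rho> [^] Suc k) (pr z)) - ht (act (\<rho> [^] k) (pr z))" for k z
  proof -
    have "act (\<rho> [^] Suc (Suc k)) (pr z) = act (\<rho> [^] k) (act \<rho> (act \<rho> (pr z)))"
      using \<rho> by (simp add: act_mult)
    also have "\<dots> = lc (2 * C) (act (\<rho> [^] Suc k) (pr z)) (- 1) (act (\<rho> [^] k) (pr z))"
      using \<rho> unfolding \<rho>2 by (simp add: act_mult act_lc)
    finally show ?thesis by (simp add: ht_lc)
  qed
  \<comment> \<open>\<open>N\<close> is uniform over all sequences, so the same finitely many powers
    serve every root.\<close>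
  obtain N where N: "\<forall>h :: nat \<Rightarrow> real. (\<forall>n. h (Suc (Suc n)) = 2 * C * h (Suc n) - h n) \<longrightarrow> (\<exists>k\<le>N. h k \<le> 0)"
    using recurrence_nonpos[OF C] by blast
  have "{\<gamma> \<in> \<Phi>p. g \<gamma> \<le> 0} \<subseteq> (\<Union>k\<le>N. {\<gamma> \<in> \<Phi>p. ht (act (\<rho> [^] k) \<gamma>) < 0})"
  proof
    fix \<gamma> assume \<gamma>: "\<gamma> \<in> {\<gamma> \<in> \<Phi>p. g \<gamma> \<le> 0}"
    obtain k where k: "k \<le> N" "ht (act (\<rho> [^] k) (pr \<gamma>)) \<le> 0"
      using N[rule_format, of "\<lambda>k. ht (act (\<rho> [^] k) (pr \<gamma>))"] rec by blast
    have "\<gamma> = lc 1 (orth \<gamma>) 1 (pr \<gamma>)" by (simp add: orth_def lc_def)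
    then have "ht (act (\<rho> [^] k) \<gamma>) = g \<gamma> + ht (act (\<rho> [^] k) (pr \<gamma>))"
      using act_lc[OF \<rho>k, of k 1 "orth \<gamma>" 1 "pr \<gamma>"] by (simp add: fix_orth ht_lc g_orth)
    then have "ht (act (\<rho> [^] k) \<gamma>) \<le> 0" using k \<gamma> by simp
    then have "ht (act (\<rho> [^] k) \<gamma>) < 0" using ht_act_pos_or_neg[OF \<rho>k, of \<gamma> k] \<gamma> by auto
    then show "\<gamma> \<in> (\<Union>k\<le>N. {\<gamma> \<in> \<Phi>p. ht (act (\<rho> [^] k) \<gamma>) < 0})" using k \<gamma> by blast
  qed
  then have "finite {\<gamma> \<in> \<Phi>p. g \<gamma> \<le> 0}" using finite_inversions[OF \<rho>k] finite_subset by blast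
  then show ?thesis using that lin g0 by blast
qed

text \<open>A pair of roots as below is conjugate into a finite standard parabolic root system.\<close>

lemma finite_small_inner_products:
  "finite {form x y | x y. x \<in> \<Phi> \<and> y \<in> \<Phi> \<and> \<bar>form x y\<bar> < 1}"
proof -
  define \<Phi>J where "\<Phi>J J = {\<gamma> \<in> \<Phi>. \<forall>s\<in>S - J. \<gamma> s = 0}" for J
  define \<J> where "\<J> = {J. J \<subseteq> S \<and> finite (\<Phi>J J)}"
  have "form x y \<in> (\<Union>J\<in>\<J>. (\<lambda>(x, y). form x y) ` (\<Phi>J J \<times> \<Phi>J J))"
    if xy: "x \<in> \<Phi>" "y \<in> \<Phi>" "\<bar>form x y\<bar> < 1" for x y
  proof -
    obtain f where f: "lin f" "f x = 0" "f y = 0" "finite {\<gamma> \<in> \<Phi>p. f \<gamma> \<le> 0}"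
      using ex_plane_functional xy by blast
    have "finite {\<gamma> \<in> \<Phi>p. f \<gamma> < 0}" using f(4) by (rule finite_subset[rotated]) auto
    then obtain v where v: "v \<in> carrier W" "\<And>s. s \<in> S \<Longrightarrow> f (act v (simple_root s)) \<ge> 0"
      using ex_chamber f(1) by blast
    define k where "k z = f (act v z)" for z
    have klin: "lin k" unfolding k_def using f(1) v(1) by (rule lin_act)
    have kexp: "k z = (\<Sum>s\<in>S. z s * k (simple_root s))" if "z \<in> \<Phi>" for z
      using lin_expand[OF klin, of z] root_outside that by blast
    have k0: "k (simple_root s) \<ge> 0" if "s \<in> S" for s using v that by (simp add: k_def)
    \<comment> \<open>A root has coefficients of one sign and \<open>k\<close> is non-negative on
      simple roots, so a root at which \<open>k\<close> vanishes is supported on \<open>J\<close>;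
      this moves \<open>x\<close> and \<open>y\<close> into \<open>\<Phi>J J\<close>. Conversely
      \<open>k\<close> vanishes on \<open>\<Phi>J J\<close>, so \<open>v\<close> maps it into the
      zeros of \<open>f\<close>, which are finitely many roots.\<close>
    define J where "J = {s \<in> S. k (simple_root s) = 0}"
    let ?F = "{\<gamma> \<in> \<Phi>p. f \<gamma> \<le> 0}"
    have "\<Phi>J J \<subseteq> act (inv v) ` (?F \<union> (\<lambda>\<gamma> t. - \<gamma> t) ` ?F)"
    proof
      fix \<gamma> assume \<gamma>: "\<gamma> \<in> \<Phi>J J"
      then have "k \<gamma> = 0" using kexp[of \<gamma>] by (auto simp: \<Phi>J_def J_def intro!: sum.neutral)
      then have f0: "f (act v \<gamma>) = 0" by (simp add: k_def)
      have r: "act v \<gamma> \<in> \<Phi>" using act_root v \<gamma> by (auto simp: \<Phi>J_def)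
      have img: "act v \<gamma> \<in> ?F \<union> (\<lambda>\<gamma> t. - \<gamma> t) ` ?F"
      proof (cases "ht (act v \<gamma>) > 0")
        case True
        then show ?thesis using r f0 by (simp add: positive_root_iff)
      next
        case False
        then have "(\<lambda>t. - act v \<gamma> t) \<in> ?F"
          using r f0 not_positive_root[OF r] uminus_root[OF r]
          by (simp add: positive_root_iff ht_uminus lin_uminus[OF f(1)])
        then show ?thesis by (intro UnI2 image_eqI[of _ _ "\<lambda>t. - act v \<gamma> t"]) auto
      qed
      have "\<gamma> = act (inv v) (act v \<gamma>)" using v by simp
      then show "\<gamma> \<in> act (inv v) ` (?F \<union> (\<lambda>\<gamma> t. - \<gamma> t) ` ?F)" by (rule image_eqI[OF _ img])
    qed
    then have "finite (\<Phi>J J)" using f(4) finite_subset by blast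
    then have J: "J \<in> \<J>" by (auto simp: \<J>_def J_def)
    have in_J: "act (inv v) z \<in> \<Phi>J J" if z: "z \<in> \<Phi>" "f z = 0" for z
    proof -
      let ?z = "act (inv v) z"
      have r: "?z \<in> \<Phi>" using act_root[of "inv v" z] v z by simp
      have sum0: "(\<Sum>s\<in>S. ?z s * k (simple_root s)) = 0" using kexp[OF r] z v by (simp add: k_def)
      have "\<forall>s\<in>S. ?z s * k (simple_root s) = 0"
        using root_sign[OF r]
      proof
        assume "\<forall>r\<in>S. 0 \<le> ?z r"
        then show ?thesis using sum0 finite_S k0 by (simp add: sum_nonneg_eq_0_iff)
      next
        assume "\<forall>r\<in>S. ?z r \<le> 0"
        then have "\<forall>s\<in>S. 0 \<le> - (?z s * k (simple_root s))" using k0 by (simp add: mult_nonpos_nonneg)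
        moreover have "(\<Sum>s\<in>S. - (?z s * k (simple_root s))) = 0" using sum0 by (simp add: sum_negf)
        ultimately have "\<forall>s\<in>S. - (?z s * k (simple_root s)) = 0"
          using finite_S by (subst (asm) sum_nonneg_eq_0_iff) auto
        then show ?thesis by simp
      qed
      then show ?thesis using r by (auto simp: \<Phi>J_def J_def)
    qed
    have "form x y = form (act (inv v) x) (act (inv v) y)" using v by (simp add: form_act)
    then show ?thesis using J in_J xy f by force
  qed
  then have "{form x y | x y. x \<in> \<Phi> \<and> y \<in> \<Phi> \<and> \<bar>form x y\<bar> < 1}
      \<subseteq> (\<Union>J\<in>\<J>. (\<lambda>(x, y). form x y) ` (\<Phi>J J \<times> \<Phi>J J))" by blast
  moreover have "finite (\<Union>J\<in>\<J>. (\<lambda>(x, y). form x y) ` (\<Phi>J J \<times> \<Phi>J J))"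
    using finite_S by (auto simp: \<J>_def)
  ultimately show ?thesis using finite_subset by blast
qed

end

text \<open>Koenig's lemma by well-founded induction: below x lie x itself and whatever lies below
  one of its finitely many successors.\<close>

lemma wf_finite_branching_finite:
  assumes "wf r" "\<And>x. finite {y. (y, x) \<in> r}"
  shows "finite {y. (y, x) \<in> r\<^sup>*}"
  using assms(1)
proof (induction x rule: wf_induct_rule)
  case (less x)
  have "{y. (y, x) \<in> r\<^sup>*} \<subseteq> insert x (\<Union>z\<in>{z. (z, x) \<in> r}. {y. (y, z) \<in> r\<^sup>*})"
    by (auto elim: rtranclE)
  moreover have "finite (insert x (\<Union>z\<in>{z. (z, x) \<in> r}. {y. (y, z) \<in> r\<^sup>*}))"
    using assms(2) less by auto
  ultimately show ?case by (rule finite_subset)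
qed

context finite_coxeter_system
begin

section \<open>Finiteness of the sets of roots dominating few roots\<close>

definition dominated :: "('a \<Rightarrow> real) \<Rightarrow> ('a \<Rightarrow> real) set" where
  "dominated \<beta> = {\<gamma> \<in> \<Phi>p. \<gamma> \<noteq> \<beta> \<and> dominates \<beta> \<gamma>}"

lemma finite_dominated:
  assumes "\<beta> \<in> \<Phi>"
  shows "finite (dominated \<beta>)"
proof -
  obtain w where w: "w \<in> carrier W" "ht (act w \<beta>) < 0" using ex_inverting assms by blast
  then have "dominated \<beta> \<subseteq> {\<gamma> \<in> \<Phi>p. ht (act w \<gamma>) < 0}"
    by (auto simp: dominated_def dest: dominatesD)
  then show ?thesis using finite_inversions[OF w(1)] finite_subset by blast
qed

lemma form_refl_simple: "s \<in> S \<Longrightarrow> form (refl s x) (simple_root s) = - form x (simple_root s)"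
  by (simp add: refl_eq_lc form_lc)

lemma refl_neq_simple_root:
  assumes "\<beta> \<in> \<Phi>p" "s \<in> S"
  shows "refl s \<beta> \<noteq> simple_root s"
proof
  assume "refl s \<beta> = simple_root s"
  then have "\<beta> = refl s (simple_root s)" using assms by (metis refl_refl)
  then show False using assms by (simp add: positive_root_iff refl_simple_same ht_uminus)
qed

text \<open>The bound -1 is what keeps \<alpha>_s, the only positive root that s makes negative, out
  of the left-hand side.\<close>

lemma dominated_refl:
  assumes "\<beta> \<in> \<Phi>p" "s \<in> S" "\<beta> \<noteq> simple_root s" "form \<beta> (simple_root s) > - 1"
  shows "dominated (refl s \<beta>) \<subseteq> refl s ` dominated \<beta>"
proof
  fix \<gamma> assume "\<gamma> \<in> dominated (refl s \<beta>)"
  then have \<gamma>: "\<gamma> \<in> \<Phi>p" "\<gamma> \<noteq> refl s \<beta>" "dominates (refl s \<beta>) \<gamma>" by (auto simp: dominated_def)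
  have r: "refl s \<beta> \<in> \<Phi>p" using assms by (intro refl_positive)
  have "\<gamma> \<noteq> simple_root s"
    using form_ge_1_if_dominates[OF r \<gamma>(1,3)] assms form_refl_simple[of s \<beta>] by auto
  then have "refl s \<gamma> \<in> \<Phi>p" using refl_positive \<gamma> assms by blast
  moreover have "refl s \<gamma> \<noteq> \<beta>" using \<gamma> assms by (metis refl_refl)
  moreover have "dominates \<beta> (refl s \<gamma>)"
    using dominates_act[OF \<gamma>(3), of s] assms by (simp add: act_S)
  ultimately have "refl s \<gamma> \<in> dominated \<beta>" by (simp add: dominated_def)
  moreover have "\<gamma> = refl s (refl s \<gamma>)" using assms by simp
  ultimately show "\<gamma> \<in> refl s ` dominated \<beta>" by blast
qed

text \<open>The elementary (or small) roots of Brink and Howlett.\<close>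

definition elementary :: "('a \<Rightarrow> real) set" where
  "elementary = {\<beta> \<in> \<Phi>p. dominated \<beta> = {}}"

lemma elementary_positive: "\<beta> \<in> elementary \<Longrightarrow> \<beta> \<in> \<Phi>p"
  by (simp add: elementary_def)

lemma elementary_not_dominates:
  "\<lbrakk>\<beta> \<in> elementary; \<gamma> \<in> \<Phi>p; dominates \<beta> \<gamma>\<rbrakk> \<Longrightarrow> \<gamma> = \<beta>"
  by (auto simp: elementary_def dominated_def)

lemma elementary_form_less_1:
  assumes "\<beta> \<in> elementary" "s \<in> S" "\<beta> \<noteq> simple_root s"
  shows "form \<beta> (simple_root s) < 1"
  using dominates_simple_iff(1)[OF elementary_positive assms(2,3)]
    elementary_not_dominates[OF assms(1), of "simple_root s"] assms by fastforce

lemma elementary_down: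
  assumes "\<beta> \<in> elementary" "s \<in> S" "\<beta> \<noteq> simple_root s" "form \<beta> (simple_root s) > 0"
  shows "refl s \<beta> \<in> elementary"
  using dominated_refl[of \<beta> s] refl_positive[of \<beta> s] assms by (auto simp: elementary_def)

lemma elementary_eq_if_form_ge_1:
  assumes "\<beta> \<in> elementary" "\<gamma> \<in> elementary" "form \<beta> \<gamma> \<ge> 1"
  shows "\<beta> = \<gamma>"
  using dominates_if_form_ge_1[of \<beta> \<gamma>] elementary_not_dominates[of \<beta> \<gamma>]
    elementary_not_dominates[of \<gamma> \<beta>] elementary_positive assms by blast

text \<open>
  Let \<open>I\<close> be the set of letters occurring infinitely often in an infinite ascending path of
  elementary roots. Between two uses of the letter \<open>t\<close> the inner product with \<open>\<alpha>\<^sub>t\<close> decreases, so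
  for \<open>t \<in> I\<close> it stays in \<open>(- 1, 1]\<close> and takes finitely many values. Two roots on the path with
  the same inner products differ by a radical vector of the span of the \<open>\<alpha>\<^sub>t\<close>, \<open>t \<in> I\<close>, so
  their inner product is 1.
\<close>

lemma no_infinite_elementary_path:
  assumes f: "\<And>i. f i \<in> elementary" and s: "\<And>i. s i \<in> S"
    and neg: "\<And>i. form (f i) (simple_root (s i)) < 0"
    and step: "\<And>i :: nat. f (Suc i) = refl (s i) (f i)"
  shows False
proof -
  have fp: "f i \<in> \<Phi>p" for i using f elementary_positive by blast
  have "ht (f i) < ht (f (Suc i))" for i
    using neg[of i] s[of i] by (simp add: step refl_eq_lc ht_lc)
  then have "strict_mono (\<lambda>i. ht (f i))" by (simp add: strict_mono_Suc_iff)
  then have inj: "f i \<noteq> f j" if "i < j" for i j using strict_monoD that by fastforce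
  \<comment> \<open>The next root of the path is elementary too, so its inner product with the same
    simple root, which is the negative of this one, is below 1.\<close>
  have short: "form (f i) (simple_root (s i)) > - 1" for i
    using elementary_form_less_1[OF f[of "Suc i"] s[of i]] refl_neq_simple_root[OF fp[of i] s[of i]]
      form_refl_simple[OF s[of i], of "f i"] by (simp add: step)
  define I where "I = {t \<in> S. \<forall>m. \<exists>j\<ge>m. s j = t}"
  have "\<forall>t\<in>S - I. \<exists>m. \<forall>j\<ge>m. s j \<noteq> t" by (auto simp: I_def)
  then obtain m where m: "\<And>t j. t \<in> S - I \<Longrightarrow> m t \<le> j \<Longrightarrow> s j \<noteq> t" by metis
  \<comment> \<open>The sum bounds every \<open>m t\<close> with t in S. The values of
    \<open>m\<close> on \<open>I\<close> are arbitrary and can only enlarge it.\<close>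
  define N where "N = sum m S"
  have sI: "s i \<in> I" if "N \<le> i" for i
  proof (rule ccontr)
    assume "s i \<notin> I"
    moreover have "m (s i) \<le> N" unfolding N_def using finite_S s by (intro member_le_sum) auto
    ultimately show False using m[of "s i" i] s that by auto
  qed
  have lower: "form (f i) (simple_root t) > - 1" if t: "t \<in> I" for i t
  proof -
    have "s (i + d) = t \<Longrightarrow> form (f i) (simple_root t) > - 1" for d
    proof (induction d arbitrary: i)
      case 0
      then show ?case using short[of i] by simp
    next
      case (Suc d)
      show ?case
      proof (cases "s i = t")
        case True
        then show ?thesis using short[of i] by simp
      next
        case False
        have "form (f i) (simple_root (s i)) * form (simple_root (s i)) (simple_root t) \<ge> 0"
          using neg[of i] form_simple_nonpos[OF s[of i] _ False] t by (intro mult_nonpos_nonpos) (auto simp: I_def)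
        then have "form (f (Suc i)) (simple_root t) \<le> form (f i) (simple_root t)"
          by (simp add: step refl_eq_lc form_lc)
        then show ?thesis using Suc.IH[of "Suc i"] Suc.prems by simp
      qed
    qed
    moreover obtain j where "j \<ge> i" "s j = t" using t by (auto simp: I_def)
    then have "s (i + (j - i)) = t" by simp
    ultimately show ?thesis by blast
  qed
  define V where "V = insert 1 {form x y | x y. x \<in> \<Phi> \<and> y \<in> \<Phi> \<and> \<bar>form x y\<bar> < 1}"
  have V: "form (f i) (simple_root t) \<in> V" if t: "t \<in> I" for i t
  proof (cases "f i = simple_root t")
    case True
    then show ?thesis using t by (simp add: V_def I_def)
  next
    case False
    then have "\<bar>form (f i) (simple_root t)\<bar> < 1"
      using elementary_form_less_1[OF f, of t i] lower[OF t, of i] t by (auto simp: I_def)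
    moreover have "f i \<in> \<Phi>" "simple_root t \<in> \<Phi>" using fp t by (auto simp: I_def)
    ultimately show ?thesis unfolding V_def by blast
  qed
  define v where "v i = (\<lambda>t. if t \<in> I then form (f i) (simple_root t) else 0)" for i
  have "finite I" using finite_S by (simp add: I_def)
  moreover have "finite V" by (simp add: V_def finite_small_inner_products)
  ultimately have "finite {h. \<forall>t. (t \<in> I \<longrightarrow> h t \<in> V) \<and> (t \<notin> I \<longrightarrow> h t = 0)}"
    by (rule finite_set_of_finite_funs)
  moreover have "range (\<lambda>i. v (N + i)) \<subseteq> {h. \<forall>t. (t \<in> I \<longrightarrow> h t \<in> V) \<and> (t \<notin> I \<longrightarrow> h t = 0)}"
    using V by (auto simp: v_def)
  ultimately have "finite (range (\<lambda>i. v (N + i)))" by (rule rev_finite_subset)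
  then have "\<not> inj (\<lambda>i. v (N + i))" using finite_imageD infinite_UNIV_nat by blast
  then obtain a b where "a \<noteq> b" "v (N + a) = v (N + b)" by (auto simp: inj_def)
  then obtain i j where ij: "N \<le> i" "i < j" "v i = v j"
    by (metis le_add1 linorder_neqE_nat nat_add_left_cancel_less)
  have const: "f (i + k) t = f i t" if "t \<notin> I" for k t
  proof (induction k)
    case (Suc k)
    have "s (i + k) \<noteq> t" using sI[of "i + k"] ij that by auto
    then show ?case using Suc by (simp add: step simple_reflection_def simple_root_def)
  qed simp
  \<comment> \<open>The product of \<open>\<delta>\<close> with itself is 2 - 2
    \<open>form (f i) (f j)\<close>. It vanishes because, for every t in S, either the coefficient
    of \<open>\<delta>\<close> at t or its product with \<alpha>_t is 0.\<close>
  define \<delta> where "\<delta> = lc 1 (f j) (- 1) (f i)"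
  have "\<delta> t * form (simple_root t) \<delta> = 0" if "t \<in> S" for t
  proof (cases "t \<in> I")
    case True
    then have "form (f j) (simple_root t) = form (f i) (simple_root t)"
      using fun_cong[OF ij(3), of t] by (simp add: v_def)
    then show ?thesis by (simp add: \<delta>_def form_lc form_commute[of "simple_root t"])
  next
    case False
    then show ?thesis using const[of t "j - i"] ij by (simp add: \<delta>_def lc_apply)
  qed
  then have "form \<delta> \<delta> = 0" by (subst form_expand_left) (simp add: sum.neutral)
  then have "form (f i) (f j) = 1"
    using fp form_root_self by (simp add: \<delta>_def form_lc form_commute[of "f j" "f i"] \<Phi>p_root)
  then show False using elementary_eq_if_form_ge_1[OF f f, of i j] inj[OF ij(2)] by simp
qed

lemma finite_elementary: "finite elementary"
proof -
  \<comment> \<open>The pairs are oriented upwards in the root poset: a descending chain of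
    \<open>r\<close> is a path of ascents.\<close>
  define r where "r = {(y, x). x \<in> elementary \<and> y \<in> elementary \<and>
    (\<exists>s\<in>S. form x (simple_root s) < 0 \<and> y = refl s x)}"
  have "wf r"
  proof (rule ccontr)
    assume "\<not> wf r"
    then obtain f where f: "\<And>i. (f (Suc i), f i) \<in> r"
      unfolding wf_iff_no_infinite_down_chain by blast
    then have "\<forall>i. \<exists>s. s \<in> S \<and> form (f i) (simple_root s) < 0 \<and> f (Suc i) = refl s (f i)"
      by (auto simp: r_def)
    then obtain s where "\<And>i. s i \<in> S \<and> form (f i) (simple_root (s i)) < 0 \<and> f (Suc i) = refl (s i) (f i)"
      by metis
    moreover have "f i \<in> elementary" for i using f[of i] by (simp add: r_def)
    ultimately show False using no_infinite_elementary_path[of f s] by blast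
  qed
  moreover have "finite {y. (y, x) \<in> r}" for x
  proof (rule finite_subset)
    show "{y. (y, x) \<in> r} \<subseteq> (\<lambda>s. refl s x) ` S" by (auto simp: r_def)
  qed (use finite_S in simp)
  ultimately have fin: "finite {y. (y, x) \<in> r\<^sup>*}" for x by (rule wf_finite_branching_finite)
  have "\<beta> \<in> (\<Union>s\<in>S. {y. (y, simple_root s) \<in> r\<^sup>*})"
    if "\<beta> \<in> elementary" "w \<in> carrier W" "ht (act w \<beta>) < 0" for \<beta> w
    using that
  proof (induction "len w" arbitrary: \<beta> w rule: less_induct)
    case less
    obtain u where u: "u \<in> carrier W" "ht (act u \<beta>) < 0"
      and min: "\<And>v. v \<in> carrier W \<Longrightarrow> ht (act v \<beta>) < 0 \<Longrightarrow> len u \<le> len v"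
      using ex_has_least_nat[of "\<lambda>u. u \<in> carrier W \<and> ht (act u \<beta>) < 0" w len] less.prems by blast
    have \<beta>p: "\<beta> \<in> \<Phi>p" using less.prems elementary_positive by blast
    obtain s v where sv: "s \<in> S" "v \<in> carrier W" "len v < len u" "form \<beta> (simple_root s) > 0"
      "ht (act v (refl s \<beta>)) < 0"
      using root_down[OF \<beta>p u min] by blast
    show ?case
    proof (cases "\<beta> = simple_root s")
      case True
      then show ?thesis using sv by blast
    next
      case False
      have e: "refl s \<beta> \<in> elementary" using elementary_down[OF less.prems(1) sv(1) False sv(4)] .
      have "len v < len w" using sv(3) min[OF less.prems(2,3)] by simp
      then obtain t where t: "t \<in> S" "(refl s \<beta>, simple_root t) \<in> r\<^sup>*"
        using less.hyps[OF _ e sv(2,5)] by blast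
      have "form (refl s \<beta>) (simple_root s) < 0 \<and> \<beta> = refl s (refl s \<beta>)"
        using form_refl_simple[of s \<beta>] sv by simp
      then have "(\<beta>, refl s \<beta>) \<in> r"
        using e less.prems(1) sv(1) unfolding r_def by blast
      then show ?thesis using t converse_rtrancl_into_rtrancl by fast
    qed
  qed
  then have "elementary \<subseteq> (\<Union>s\<in>S. {y. (y, simple_root s) \<in> r\<^sup>*})"
    using ex_inverting elementary_positive by (metis \<Phi>p_root subsetI)
  then show ?thesis using fin finite_S by (meson finite_UN finite_subset)
qed

section \<open>Reflection in an elementary root lowers the number of dominated roots\<close>

definition reflect :: "('a \<Rightarrow> real) \<Rightarrow> ('a \<Rightarrow> real) \<Rightarrow> 'a \<Rightarrow> real" where
  "reflect a x = lc 1 x (- 2 * form x a) a"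

lemma reflect_reflect: "a \<in> \<Phi> \<Longrightarrow> reflect a (reflect a x) = x"
  by (rule ext) (simp add: reflect_def form_lc form_root_self lc_apply)

lemma reflect_root: 
  assumes "a \<in> \<Phi>" "x \<in> \<Phi>"
  shows "reflect a x \<in> \<Phi>"
proof -
  obtain r where "r \<in> carrier W" "\<And>z. act r z = reflect a z"
    unfolding reflect_def using ex_reflection assms by blast
  then show ?thesis using act_root[of r x] assms by metis
qed

lemma dominates_reflect:
  assumes "a \<in> \<Phi>" "dominates x y"
  shows "dominates (reflect a x) (reflect a y)"
proof -
  obtain r where "r \<in> carrier W" "\<And>z. act r z = reflect a z"
    unfolding reflect_def using ex_reflection assms by blast
  then show ?thesis using dominates_act[of x y r] assms by metis
qed

text \<open>Otherwise the negative \<beta>' of the reflected root is positive with \<langle>a,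
  \<beta>'\<rangle> = \<langle>\<beta>, a\<rangle> \<ge> 1, so one of a and \<beta>' dominates the
  other. If a dominates \<beta>', then \<beta>' = a and so \<beta> = a; in the opposite case
  reflection in a shows that a dominates \<beta>. Both are impossible.\<close>

lemma reflect_elementary_positive:
  assumes \<beta>: "\<beta> \<in> \<Phi>p" and a: "a \<in> elementary" and dom: "a \<in> dominated \<beta>"
  shows "reflect a \<beta> \<in> \<Phi>p"
proof (rule ccontr)
  assume np: "reflect a \<beta> \<notin> \<Phi>p"
  have ap: "a \<in> \<Phi>p" and a\<Phi>: "a \<in> \<Phi>" and \<beta>\<Phi>: "\<beta> \<in> \<Phi>" using a \<beta> elementary_positive by auto
  have d: "dominates \<beta> a" "a \<noteq> \<beta>" using dom by (auto simp: dominated_def)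
  define \<beta>' where "\<beta>' = (\<lambda>t. - reflect a \<beta> t)"
  have "reflect a \<beta> \<in> \<Phi>" using reflect_root a\<Phi> \<beta>\<Phi> by blast
  then have \<beta>': "\<beta>' \<in> \<Phi>p"
    using np not_positive_root[of "reflect a \<beta>"] uminus_root
    by (auto simp: positive_root_iff \<beta>'_def ht_uminus)
  have c: "form \<beta> a \<ge> 1" using form_ge_1_if_dominates[OF \<beta> ap d(1)] .
  have eq: "\<beta>' = lc (2 * form \<beta> a) a (- 1) \<beta>" by (simp add: \<beta>'_def reflect_def lc_def)
  have "form a \<beta>' = form \<beta> a"
    using a\<Phi> by (simp add: eq form_lc form_root_self form_commute[of a \<beta>])
  then consider "dominates a \<beta>'" | "dominates \<beta>' a"
    using dominates_if_form_ge_1[OF ap \<beta>'] c by auto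
  then show False
  proof cases
    case 1
    then have "\<beta>' = a" using elementary_not_dominates[OF a \<beta>'] by blast
    then have "(\<lambda>t. - a t) = reflect a \<beta>" by (auto simp: \<beta>'_def fun_eq_iff minus_equation_iff)
    moreover have "(\<lambda>t. - a t) = reflect a a"
      using a\<Phi> by (simp add: reflect_def lc_def form_root_self)
    ultimately show False using reflect_reflect[OF a\<Phi>] d(2) by metis
  next
    case 2
    obtain r where r: "r \<in> carrier W" "\<And>z. act r z = reflect a z"
      unfolding reflect_def using ex_reflection a\<Phi> by blast
    have r\<beta>: "act r \<beta>' = (\<lambda>t. - \<beta> t)"
      using act_uminus[OF r(1), of "reflect a \<beta>"] reflect_reflect[OF a\<Phi>, of \<beta>] r(2)[of "reflect a \<beta>"]
      unfolding \<beta>'_def by simp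
    have ra: "act r a = (\<lambda>t. - a t)" using a\<Phi> by (simp add: r(2) reflect_def lc_def form_root_self)
    have "dominates a \<beta>" unfolding dominates_def
    proof (intro ballI impI, rule ccontr)
      fix w assume w: "w \<in> carrier W" and neg: "ht (act w a) < 0" and "\<not> ht (act w \<beta>) < 0"
      then have "ht (act w \<beta>) > 0" using ht_act_pos_or_neg[OF w \<beta>\<Phi>] by blast
      then have "ht (act (w \<otimes> r) \<beta>') < 0"
        using w r(1) by (simp add: act_mult r\<beta> act_uminus ht_uminus)
      then have "ht (act (w \<otimes> r) a) < 0" using dominatesD[OF 2, of "w \<otimes> r"] w r by auto
      then show False using neg w r(1) by (simp add: act_mult ra act_uminus ht_uminus)
    qed
    then show False using elementary_not_dominates[OF a \<beta>] d by blast
  qed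
qed

text \<open>The roots dominated by the reflection \<beta>' of \<beta> inject into those dominated by
  \<beta> and different from a: reflect in a, but keep a root whose reflection would be
  negative.\<close>

lemma card_dominated_reflect:
  assumes \<beta>: "\<beta> \<in> \<Phi>p" and a: "a \<in> elementary" and dom: "a \<in> dominated \<beta>"
  shows "card (dominated (reflect a \<beta>)) < card (dominated \<beta>)"
proof -
  define \<beta>' where "\<beta>' = reflect a \<beta>"
  have ap: "a \<in> \<Phi>p" and a\<Phi>: "a \<in> \<Phi>" and \<beta>\<Phi>: "\<beta> \<in> \<Phi>" using a \<beta> elementary_positive by auto
  have d: "dominates \<beta> a" using dom by (auto simp: dominated_def)
  have \<beta>': "\<beta>' \<in> \<Phi>p" using reflect_elementary_positive[OF assms] by (simp add: \<beta>'_def)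
  define c where "c = form \<beta> a"
  have c: "c \<ge> 1" using form_ge_1_if_dominates[OF \<beta> ap d] by (simp add: c_def)
  have fa: "form a a = 1" "form \<beta> \<beta> = 1" using a\<Phi> \<beta>\<Phi> by (simp_all add: form_root_self)
  have \<beta>'a: "form \<beta>' a = - c" by (simp add: \<beta>'_def reflect_def form_lc fa c_def)
  have \<beta>'\<beta>: "form \<beta>' \<beta> < 1"
  proof -
    have "c * c \<ge> 1 * 1" using c by (intro mult_mono) auto
    then show ?thesis
      by (simp add: \<beta>'_def reflect_def form_lc fa c_def[symmetric] form_commute[of a \<beta>])
  qed
  have r\<beta>': "reflect a \<beta>' = \<beta>" using reflect_reflect[OF a\<Phi>] by (simp add: \<beta>'_def)
  define g where "g \<gamma> = (if ht (reflect a \<gamma>) > 0 then reflect a \<gamma> else \<gamma>)" for \<gamma>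
  have "g ` dominated \<beta>' \<subseteq> dominated \<beta> - {a}"
  proof
    fix \<kappa> assume "\<kappa> \<in> g ` dominated \<beta>'"
    then obtain \<gamma> where \<gamma>: "\<gamma> \<in> \<Phi>p" "\<gamma> \<noteq> \<beta>'" "dominates \<beta>' \<gamma>" and \<kappa>: "\<kappa> = g \<gamma>"
      by (auto simp: dominated_def)
    have r: "reflect a \<gamma> \<in> \<Phi>" using reflect_root a\<Phi> \<gamma> by blast
    show "\<kappa> \<in> dominated \<beta> - {a}"
    proof (cases "ht (reflect a \<gamma>) > 0")
      case True
      then have k: "\<kappa> = reflect a \<gamma>" by (simp add: \<kappa> g_def)
      have "\<kappa> \<in> \<Phi>p" using True r by (simp add: k positive_root_iff)
      moreover have "\<kappa> \<noteq> \<beta>" using \<gamma>(2) reflect_reflect[OF a\<Phi>, of \<gamma>] by (auto simp: k \<beta>'_def)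
      moreover have "dominates \<beta> \<kappa>" using dominates_reflect[OF a\<Phi> \<gamma>(3)] by (simp add: r\<beta>' k)
      moreover have "\<kappa> \<noteq> a"
      proof
        assume "\<kappa> = a"
        then have "\<gamma> = reflect a a" using reflect_reflect[OF a\<Phi>, of \<gamma>] by (simp add: k)
        then have "ht \<gamma> = - ht a" by (simp add: reflect_def ht_lc fa)
        then show False using \<gamma> ap by (simp add: positive_root_iff)
      qed
      ultimately show ?thesis by (simp add: dominated_def)
    next
      case False
      then have k: "\<kappa> = \<gamma>" by (simp add: \<kappa> g_def)
      \<comment> \<open>A kept root has a positive inner product with \<open>a\<close>, so
        reflecting \<open>\<beta>'\<close> back to \<open>\<beta>\<close> raises the inner product
        with \<open>\<gamma>\<close> above 1. Hence one of \<open>\<gamma>\<close> and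
        \<open>\<beta>\<close> dominates the other. It is not \<open>\<gamma>\<close>, for then
        \<open>\<beta>'\<close> would dominate \<open>\<beta>\<close> although their inner product
        is below 1.\<close>
      have "ht (reflect a \<gamma>) < 0" using False not_positive_root[OF r] by blast
      then have "ht \<gamma> < 2 * form \<gamma> a * ht a" by (simp add: reflect_def ht_lc)
      moreover have "ht \<gamma> > 0" "ht a > 0" using \<gamma> ap by (auto simp: positive_root_iff)
      ultimately have "form \<gamma> a * ht a > 0" by linarith
      then have ga: "form \<gamma> a > 0" using \<open>ht a > 0\<close> by (simp add: zero_less_mult_iff)
      have b1: "form \<beta>' \<gamma> \<ge> 1" using form_ge_1_if_dominates[OF \<beta>' \<gamma>(1,3)] .
      have "form \<gamma> \<beta> = form \<gamma> (reflect a \<beta>')" by (simp add: r\<beta>')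
      also have "\<dots> = form \<beta>' \<gamma> + 2 * (c * form \<gamma> a)"
        by (simp add: reflect_def form_lc \<beta>'a form_commute[of \<gamma> \<beta>'])
      finally have gb: "form \<gamma> \<beta> > 1" using b1 c ga
        by (smt (verit) mult_pos_pos)
      then have "\<gamma> \<noteq> \<beta>" using fa by auto
      moreover have "\<not> dominates \<gamma> \<beta>"
        using dominates_trans[OF \<gamma>(3)] form_ge_1_if_dominates[OF \<beta>' \<beta>] \<beta>'\<beta> by force
      then have "dominates \<beta> \<gamma>" using dominates_if_form_ge_1[OF \<gamma>(1) \<beta>] gb by auto
      moreover have "\<gamma> \<noteq> a" using b1 \<beta>'a c by auto
      ultimately show ?thesis using \<gamma> by (simp add: k dominated_def)
    qed
  qed
  moreover have fin: "finite (dominated \<beta>)" using finite_dominated \<beta>\<Phi> by blast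
  ultimately have "card (g ` dominated \<beta>') \<le> card (dominated \<beta> - {a})" by (intro card_mono) auto
  also have "\<dots> < card (dominated \<beta>)" by (rule card_Diff1_less[OF fin dom])
  also have "card (g ` dominated \<beta>') = card (dominated \<beta>')"
  proof (rule card_image, rule inj_onI)
    fix x y assume xy: "x \<in> dominated \<beta>'" "y \<in> dominated \<beta>'" "g x = g y"
    have "ht x > 0" "ht y > 0" using xy by (auto simp: dominated_def positive_root_iff)
    \<comment> \<open>The mixed case does not occur: if \<open>y\<close> is the reflection of
      \<open>x\<close>, then the reflection of \<open>y\<close> is the positive root
      \<open>x\<close>, so \<open>y\<close> is not kept.\<close>
    then show "x = y" using xy(3) reflect_reflect[OF a\<Phi>, of x] reflect_reflect[OF a\<Phi>, of y]
      unfolding g_def by (metis)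
  qed
  finally show ?thesis by (simp add: \<beta>'_def)
qed

text \<open>The n-small roots. The dominated sets of roots are finite, so n = 0 gives exactly the
  elementary roots.\<close>

definition few_dominated :: "nat \<Rightarrow> ('a \<Rightarrow> real) set" where
  "few_dominated n = {\<beta> \<in> \<Phi>p. card (dominated \<beta>) \<le> n}"

text \<open>A member of \<open>dominated \<beta>\<close> that itself dominates as few roots as
  possible is elementary: by transitivity and antisymmetry any root strictly below it dominates
  strictly fewer.\<close>

lemma ex_elementary_dominated:
  assumes "\<beta> \<in> \<Phi>p" "dominated \<beta> \<noteq> {}"
  obtains a where "a \<in> elementary" "a \<in> dominated \<beta>"
proof -
  obtain b where "b \<in> dominated \<beta>" using assms by blast
  then obtain a where a: "a \<in> dominated \<beta>"
    and min: "\<And>b. b \<in> dominated \<beta> \<Longrightarrow> card (dominated a) \<le> card (dominated b)"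
    using ex_has_least_nat[of "\<lambda>a. a \<in> dominated \<beta>" b "\<lambda>a. card (dominated a)"] by blast
  have ap: "a \<in> \<Phi>p" "dominates \<beta> a" "a \<noteq> \<beta>" using a by (auto simp: dominated_def)
  have "dominated a = {}"
  proof (rule ccontr)
    assume "dominated a \<noteq> {}"
    then obtain b where b: "b \<in> \<Phi>p" "b \<noteq> a" "dominates a b" by (auto simp: dominated_def)
    have "b \<noteq> \<beta>" using dominates_antisym ap b assms by blast
    then have "b \<in> dominated \<beta>" using b ap dominates_trans[of \<beta> a b] by (simp add: dominated_def)
    moreover have "dominated b \<subset> dominated a"
    proof
      show "dominated b \<subseteq> dominated a"
      proof
        fix x assume x: "x \<in> dominated b"
        then have "x \<noteq> a" using b ap dominates_antisym[of a b] by (auto simp: dominated_def)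
        then show "x \<in> dominated a" using x b dominates_trans[of a b x] by (auto simp: dominated_def)
      qed
      show "dominated b \<noteq> dominated a" using b by (auto simp: dominated_def)
    qed
    then have "card (dominated b) < card (dominated a)"
      using finite_dominated[of a] ap by (intro psubset_card_mono) auto
    ultimately show False using min by fastforce
  qed
  then show ?thesis using that[of a] a ap by (simp add: elementary_def)
qed

lemma finite_few_dominated: "finite (few_dominated n)"
proof (induction n)
  case 0
  have "few_dominated 0 = elementary"
    using finite_dominated by (auto simp: few_dominated_def elementary_def)
  then show ?case by (simp add: finite_elementary)
next
  case (Suc n)
  have "few_dominated (Suc n) \<subseteq> few_dominated n \<union> (\<Union>a\<in>elementary. reflect a ` few_dominated n)"
  proof
    fix \<beta> assume \<beta>: "\<beta> \<in> few_dominated (Suc n)"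
    show "\<beta> \<in> few_dominated n \<union> (\<Union>a\<in>elementary. reflect a ` few_dominated n)"
    proof (cases "dominated \<beta> = {}")
      case True
      then show ?thesis using \<beta> by (auto simp: few_dominated_def)
    next
      case False
      have \<beta>p: "\<beta> \<in> \<Phi>p" using \<beta> by (simp add: few_dominated_def)
      obtain a where a: "a \<in> elementary" "a \<in> dominated \<beta>"
        using ex_elementary_dominated \<beta>p False by blast
      have "reflect a \<beta> \<in> few_dominated n"
        using reflect_elementary_positive[OF \<beta>p a] card_dominated_reflect[OF \<beta>p a] \<beta>
        by (auto simp: few_dominated_def)
      moreover have "\<beta> = reflect a (reflect a \<beta>)"
        using reflect_reflect[of a] elementary_positive[OF a(1)] by auto
      ultimately show ?thesis using a by blast
    qed
  qed
  then show ?case using Suc finite_elementary finite_subset by blast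
qed

lemma simple_root_few_dominated: "s \<in> S \<Longrightarrow> simple_root s \<in> few_dominated n"
proof -
  assume s: "s \<in> S"
  then have "dominated (simple_root s) = {}"
    using dominates_simple_iff(2)[of _ s] by (auto simp: dominated_def)
  then show ?thesis using s by (simp add: few_dominated_def)
qed

lemma refl_few_dominated:
  assumes "\<beta> \<in> few_dominated n" "s \<in> S" "\<beta> \<noteq> simple_root s" "form \<beta> (simple_root s) > - 1"
  shows "refl s \<beta> \<in> few_dominated n"
proof -
  have \<beta>: "\<beta> \<in> \<Phi>p" "card (dominated \<beta>) \<le> n" using assms by (auto simp: few_dominated_def)
  have fin: "finite (dominated \<beta>)" using finite_dominated \<beta> by blast
  have "card (dominated (refl s \<beta>)) \<le> card (refl s ` dominated \<beta>)"
    using dominated_refl[OF \<beta>(1) assms(2-4)] fin by (intro card_mono) auto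
  also have "\<dots> \<le> n" using card_image_le[OF fin, of "refl s"] \<beta> by simp
  finally show ?thesis using refl_positive \<beta> assms by (simp add: few_dominated_def)
qed

end

section \<open>Counting parts under refinement\<close>

lemma partition_on_same_part:
  "\<lbrakk>partition_on A Q; p \<in> Q; q \<in> Q; x \<in> p; x \<in> q\<rbrakk> \<Longrightarrow> p = q"
  unfolding partition_on_def disjoint_def by blast

lemma refines_finite_card_le:
  assumes "refines A R Q" "finite R"
  shows "finite Q \<and> card Q \<le> card R"
proof -
  define f where "f r = (SOME q. q \<in> Q \<and> r \<subseteq> q)" for r
  have "Q \<subseteq> f ` R"
  proof
    fix q assume q: "q \<in> Q"
    obtain x where x: "x \<in> q" "x \<in> A"
      using assms(1) q unfolding refines_def partition_on_def by (metis UnionI ex_in_conv)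
    then obtain r where r: "r \<in> R" "x \<in> r"
      using assms(1) unfolding refines_def partition_on_def by blast
    then have "\<exists>q. q \<in> Q \<and> r \<subseteq> q" using assms(1) unfolding refines_def by blast
    then have "f r \<in> Q \<and> r \<subseteq> f r" unfolding f_def by (rule someI_ex)
    moreover have "partition_on A Q" using assms(1) by (simp add: refines_def)
    ultimately have "f r = q" using partition_on_same_part[of A Q "f r" q x] q x r by blast
    then show "q \<in> f ` R" using r by blast
  qed
  then show ?thesis
    using assms(2) card_image_le[of R f] card_mono[of "f ` R" Q] finite_subset[of Q "f ` R"] by fastforce
qed

context coxeter_system
begin

section \<open>Simple refinements\<close>

lemma part_descents_eq:
  assumes "locally_constant W S Q" "P \<in> Q" "w \<in> P"
  shows "part_descents W S P = left_descents W S w"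
  unfolding part_descents_def
  using assms unfolding locally_constant_def by (intro the_equality) blast+

lemma l_coset_iff:
  assumes "P \<subseteq> carrier W" "s \<in> S"
  shows "x \<in> s <# P \<longleftrightarrow> x \<in> carrier W \<and> s \<otimes> x \<in> P"
proof
  assume "x \<in> s <# P"
  then obtain p where "p \<in> P" "x = s \<otimes> p" by (auto simp: l_coset_def)
  then show "x \<in> carrier W \<and> s \<otimes> x \<in> P" using assms by auto
next
  assume x: "x \<in> carrier W \<and> s \<otimes> x \<in> P"
  then have "x = s \<otimes> (s \<otimes> x)" using assms by simp
  then show "x \<in> s <# P" using x unfolding l_coset_def by blast
qed

lemma l_coset_subset_iff: "s <# P \<subseteq> P' \<longleftrightarrow> (\<forall>x\<in>P. s \<otimes> x \<in> P')"
  by (auto simp: l_coset_def)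

lemma locally_constant_partition: "locally_constant W S Q \<Longrightarrow> partition_on (carrier W) Q"
  by (simp add: locally_constant_def)

lemma part_subset: "\<lbrakk>locally_constant W S Q; P \<in> Q\<rbrakk> \<Longrightarrow> P \<subseteq> carrier W"
  unfolding locally_constant_def partition_on_def by blast

text \<open>Since s is an involution, intersecting P with the sets sP' sorts the elements of P by
  the part that contains their translate under s.\<close>

lemma simple_refinement_eq:
  assumes lc: "locally_constant W S Q" and P: "P \<in> Q" and s: "s \<in> S"
  shows "simple_refinement W Q P s = (Q - {P}) \<union>
    {{x \<in> P. s \<otimes> x \<in> P'} | P'. P' \<in> Q \<and> (\<exists>x\<in>P. s \<otimes> x \<in> P')}"
proof -
  have 1: "P \<inter> (s <# P') = {x \<in> P. s \<otimes> x \<in> P'}" if "P' \<in> Q" for P'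
    using l_coset_iff[OF part_subset[OF lc that] s] part_subset[OF lc P] by auto
  have 2: "P' \<inter> (s <# P) \<noteq> {} \<longleftrightarrow> (\<exists>x\<in>P. s \<otimes> x \<in> P')" for P'
    by (auto simp: l_coset_def)
  show ?thesis unfolding simple_refinement_def 2 using 1 by blast
qed

lemma simple_refinement_refines:
  assumes lc: "locally_constant W S Q" and P: "P \<in> Q" and s: "s \<in> S"
  shows "refines (carrier W) (simple_refinement W Q P s) Q"
proof -
  let ?Q = "simple_refinement W Q P s"
  note eq = simple_refinement_eq[OF assms]
  have pQ: "partition_on (carrier W) Q" using locally_constant_partition lc .
  have sub: "\<exists>q\<in>Q. p \<subseteq> q" if "p \<in> ?Q" for p using that P unfolding eq by blast
  have "partition_on (carrier W) ?Q"
  proof (rule partition_onI)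
    show "\<Union> ?Q = carrier W"
    proof
      show "\<Union> ?Q \<subseteq> carrier W" using sub part_subset[OF lc] by blast
      show "carrier W \<subseteq> \<Union> ?Q"
      proof
        fix x assume x: "x \<in> carrier W"
        then obtain q where q: "q \<in> Q" "x \<in> q" using partition_onD1[OF pQ] by blast
        have "s \<otimes> x \<in> carrier W" using x s by simp
        then obtain P' where P': "P' \<in> Q" "s \<otimes> x \<in> P'" using partition_onD1[OF pQ] by blast
        show "x \<in> \<Union> ?Q"
        proof (cases "q = P")
          case True
          then have "{y \<in> P. s \<otimes> y \<in> P'} \<in> ?Q" "x \<in> {y \<in> P. s \<otimes> y \<in> P'}"
            unfolding eq using P' q by blast+
          then show ?thesis by blast
        next
          case False
          then show ?thesis unfolding eq using q by blast
        qed
      qed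
    qed
    show "{} \<notin> ?Q" unfolding eq using partition_onD3[OF pQ] by auto
    show "disjnt p q" if pq: "p \<in> ?Q" "q \<in> ?Q" "p \<noteq> q" for p q
    proof (rule ccontr)
      assume "\<not> disjnt p q"
      then obtain x where x: "x \<in> p" "x \<in> q" by (auto simp: disjnt_iff)
      have part: "p' = q'" if "p' \<in> Q" "q' \<in> Q" "y \<in> p'" "y \<in> q'" for p' q' y
        using partition_on_same_part pQ that by metis
      from pq(1) consider "p \<in> Q - {P}" | P1 where "P1 \<in> Q" "p = {y \<in> P. s \<otimes> y \<in> P1}"
        unfolding eq by blast
      then show False
      proof cases
        case 1
        from pq(2) consider "q \<in> Q - {P}" | P2 where "P2 \<in> Q" "q = {y \<in> P. s \<otimes> y \<in> P2}"
          unfolding eq by blast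
        then show False using 1 part x pq(3) P by cases blast+
      next
        case p: 2
        from pq(2) consider "q \<in> Q - {P}" | P2 where "P2 \<in> Q" "q = {y \<in> P. s \<otimes> y \<in> P2}"
          unfolding eq by blast
        then show False
        proof cases
          case 1
          then show False using p part[of q P x] x P by blast
        next
          case 2
          then show False using p part[of P1 P2 "s \<otimes> x"] x pq(3) by blast
        qed
      qed
    qed
  qed
  then show ?thesis unfolding refines_def using pQ sub by blast
qed

lemma locally_constant_refines:
  assumes "locally_constant W S Q" "refines (carrier W) R Q"
  shows "locally_constant W S R"
  unfolding locally_constant_def
proof (intro conjI ballI)
  show "partition_on (carrier W) R" using assms(2) by (simp add: refines_def)
  fix P v w assume "P \<in> R" "v \<in> P" "w \<in> P"
  moreover then obtain P' where "P' \<in> Q" "P \<subseteq> P'" using assms(2) unfolding refines_def by blast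
  ultimately show "left_descents W S v = left_descents W S w"
    using assms(1) unfolding locally_constant_def by blast
qed

text \<open>There are at least two pieces, as sP lies in no single part, and they are new: a
  non-empty subset of P can be a part of Q only if it is P itself.\<close>

lemma simple_refinement_card:
  assumes lc: "locally_constant W S Q" and r: "refinable_at W S Q P s"
    and fin: "finite (simple_refinement W Q P s)"
  shows "card Q < card (simple_refinement W Q P s)"
proof -
  have P: "P \<in> Q" and s: "s \<in> S" and nsub: "\<And>P'. P' \<in> Q \<Longrightarrow> \<exists>x\<in>P. s \<otimes> x \<notin> P'"
    using r unfolding refinable_at_def l_coset_subset_iff by auto
  note eq = simple_refinement_eq[OF lc P s]
  have pQ: "partition_on (carrier W) Q" using locally_constant_partition lc .
  let ?N = "\<lambda>P'. {x \<in> P. s \<otimes> x \<in> P'}"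
  have ex: "\<exists>P'\<in>Q. s \<otimes> x \<in> P'" if "x \<in> P" for x
  proof -
    have "x \<in> carrier W" using that part_subset[OF lc P] by blast
    then have "s \<otimes> x \<in> carrier W" using s by simp
    then show ?thesis using partition_onD1[OF pQ] by blast
  qed
  have "P \<noteq> {}" using P partition_onD3[OF pQ] by auto
  then obtain x where x: "x \<in> P" by auto
  then obtain P1 where P1: "P1 \<in> Q" "s \<otimes> x \<in> P1" using ex by blast
  obtain y where y: "y \<in> P" "s \<otimes> y \<notin> P1" using nsub P1 by blast
  then obtain P2 where P2: "P2 \<in> Q" "s \<otimes> y \<in> P2" using ex by blast
  have ne: "?N P1 \<noteq> ?N P2" using y P2 by auto
  have "Q - {P} \<union> {?N P1, ?N P2} \<subseteq> simple_refinement W Q P s"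
    unfolding eq using P1 P2 x y by blast
  then have "card (Q - {P} \<union> {?N P1, ?N P2}) \<le> card (simple_refinement W Q P s)"
    using fin card_mono by blast
  moreover have "card (Q - {P} \<union> {?N P1, ?N P2}) = card (Q - {P}) + card {?N P1, ?N P2}"
  proof (rule card_Un_disjoint)
    show "finite (Q - {P})" using fin unfolding eq by simp
    have "?N P' \<notin> Q - {P}" if "z \<in> P" "s \<otimes> z \<in> P'" for P' z
      using partition_on_same_part[OF pQ _ P, of "?N P'" z] that by blast
    then show "(Q - {P}) \<inter> {?N P1, ?N P2} = {}" using x y P1 P2 by blast
  qed simp
  moreover have "card {?N P1, ?N P2} = 2" using ne by simp
  moreover have "card (Q - {P}) + 1 = card Q"
  proof -
    have "finite Q" using fin unfolding eq by simp
    then show ?thesis using P by (simp add: card_gt_0_iff card_Diff_singleton) (metis Suc_pred card_gt_0_iff empty_iff)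
  qed
  ultimately show ?thesis by simp
qed

text \<open>The split is forced. A part p of R inside P has the descents of P, so sp lies in one
  part of R and thus in one part P' of Q; this puts p into the piece of P that belongs to
  P'.\<close>

lemma regular_refines_simple_refinement:
  assumes lc: "locally_constant W S Q" and r: "refinable_at W S Q P s"
    and R: "regular_partition W S R" and RQ: "refines (carrier W) R Q"
  shows "refines (carrier W) R (simple_refinement W Q P s)"
proof -
  have P: "P \<in> Q" and s: "s \<in> S" and sD: "s \<notin> part_descents W S P"
    using r unfolding refinable_at_def by auto
  note eq = simple_refinement_eq[OF lc P s]
  have lR: "locally_constant W S R" using R by (simp add: regular_partition_def)
  have "\<exists>q\<in>simple_refinement W Q P s. p \<subseteq> q" if p: "p \<in> R" for p
  proof -
    obtain q where q: "q \<in> Q" "p \<subseteq> q" using RQ p unfolding refines_def by blast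
    show ?thesis
    proof (cases "q = P")
      case True
      have "p \<noteq> {}" using p lR partition_onD3 unfolding locally_constant_def by blast
      then obtain x where x: "x \<in> p" by auto
      have "part_descents W S p = part_descents W S P"
        using part_descents_eq[OF lc P] part_descents_eq[OF lR p x] x q True by auto
      then obtain p' where p': "p' \<in> R" "s <# p \<subseteq> p'"
        using R p s sD unfolding regular_partition_def by blast
      then obtain P' where P': "P' \<in> Q" "p' \<subseteq> P'" using RQ unfolding refines_def by blast
      have *: "\<forall>x\<in>p. s \<otimes> x \<in> P'" using p' P' unfolding l_coset_subset_iff by blast
      then have "p \<subseteq> {x \<in> P. s \<otimes> x \<in> P'}" using q True by blast
      moreover have "{x \<in> P. s \<otimes> x \<in> P'} \<in> simple_refinement W Q P s"
        unfolding eq using * x q True P' by blast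
      ultimately show ?thesis by blast
    next
      case False
      then show ?thesis unfolding eq using q by blast
    qed
  qed
  then show ?thesis
    using RQ simple_refinement_refines[OF lc P s] unfolding refines_def by blast
qed

lemma refinement_steps_invariant:
  assumes "(refinement_step W S)\<^sup>*\<^sup>* Q Q'" "locally_constant W S Q"
  shows "locally_constant W S Q' \<and> refines (carrier W) Q' Q \<and>
    (\<forall>R. regular_partition W S R \<longrightarrow> refines (carrier W) R Q \<longrightarrow> refines (carrier W) R Q')"
  using assms(1)
proof (induction rule: rtranclp_induct)
  case base
  then show ?case using assms(2) refines_refl locally_constant_partition by blast
next
  case (step Q1 Q2)
  then obtain P s where Ps: "refinable_at W S Q1 P s" "Q2 = simple_refinement W Q1 P s"
    by (auto simp: refinement_step_def)
  then have "refines (carrier W) Q2 Q1"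
    using simple_refinement_refines[of Q1 P s] step.IH unfolding refinable_at_def by simp
  then show ?case
    using step.IH Ps regular_refines_simple_refinement[of Q1 P s] locally_constant_refines
      refines_trans[of "carrier W" Q2 Q1 Q] by blast
qed

text \<open>The infimum is chosen among the greatest lower bounds. A least member of the family is
  one of them, and antisymmetry of refinement leaves no other.\<close>

lemma regular_completion_eqI:
  assumes Q: "regular_partition W S Q" "refines (carrier W) Q P"
    and least: "\<And>R. regular_partition W S R \<Longrightarrow> refines (carrier W) R P \<Longrightarrow> refines (carrier W) R Q"
  shows "regular_completion W S P = Q"
proof -
  let ?L = "regular_partitions W S"
  let ?A = "{R \<in> carrier ?L. partition_le W P R}"
  have g: "greatest ?L Q (Lower ?L ?A)"
    using assms unfolding greatest_def Lower_def regular_partitions_def partition_le_def by auto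
  have "Q' = Q" if "greatest ?L Q' (Lower ?L ?A)" for Q'
  proof (rule refines_asym)
    show "refines (carrier W) Q' Q" "refines (carrier W) Q Q'"
      using that g unfolding greatest_def
      by (auto simp: regular_partitions_def partition_le_def)
  qed
  then show ?thesis
    unfolding regular_completion_def inf_def using g by (intro some_equality)
qed

text \<open>Along a run of the algorithm the number of parts increases and is bounded by that of \<open>R\<close>.\<close>

lemma algorithm_correct:
  assumes lc: "locally_constant W S P"
    and R: "regular_partition W S R" "refines (carrier W) R P" "finite R"
  shows "algorithm_terminates W S P \<and>
    (\<forall>Q. algorithm_output W S P Q \<longleftrightarrow> Q = regular_completion W S P) \<and>
    finite (regular_completion W S P)"
proof -
  have inv: "locally_constant W S Q \<and> refines (carrier W) Q P \<and> finite Q \<and> card Q \<le> card R"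
    if "(refinement_step W S)\<^sup>*\<^sup>* P Q" for Q
    using refinement_steps_invariant[OF that lc] refines_finite_card_le[OF _ R(3)] R by blast
  have step: "card Q < card Q'" if "(refinement_step W S)\<^sup>*\<^sup>* P Q" "refinement_step W S Q Q'" for Q Q'
    using inv[OF that(1)] inv[OF rtranclp.rtrancl_into_rtrancl[OF that]] that(2)
      simple_refinement_card unfolding refinement_step_def by blast
  have out: "Q = regular_completion W S P \<and> finite Q" if o: "algorithm_output W S P Q" for Q
  proof -
    have r: "(refinement_step W S)\<^sup>*\<^sup>* P Q" and no: "\<not> (\<exists>P s. refinable_at W S Q P s)"
      using o by (auto simp: algorithm_output_def)
    have "regular_partition W S Q"
      using inv[OF r] no unfolding regular_partition_def refinable_at_def by blast
    then show ?thesis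
      using regular_completion_eqI[of Q P] refinement_steps_invariant[OF r lc] inv[OF r] by blast
  qed
  \<comment> \<open>Every reachable partition can be continued to an output. Starting from the
    input, this supplies the output needed for the converse direction of the equivalence.\<close>
  have ex: "\<exists>Q'. algorithm_output W S P Q'" if "(refinement_step W S)\<^sup>*\<^sup>* P Q" for Q
    using that
  proof (induction "card R - card Q" arbitrary: Q rule: less_induct)
    case less
    show ?case
    proof (cases "\<exists>P s. refinable_at W S Q P s")
      case True
      then obtain Q' where Q': "refinement_step W S Q Q'" unfolding refinement_step_def by blast
      then have r: "(refinement_step W S)\<^sup>*\<^sup>* P Q'" using less.prems by (rule rtranclp.rtrancl_into_rtrancl[rotated])
      have "card R - card Q' < card R - card Q"
        using step[OF less.prems Q'] inv[OF r] by linarith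
      then show ?thesis using less.hyps r by blast
    next
      case False
      then show ?thesis using less.prems unfolding algorithm_output_def by blast
    qed
  qed
  obtain Q0 where Q0: "algorithm_output W S P Q0" using ex by blast
  have "algorithm_terminates W S P"
    unfolding algorithm_terminates_def
  proof
    assume "\<exists>Q. Q 0 = P \<and> (\<forall>j. refinement_step W S (Q j) (Q (Suc j)))"
    then obtain Q where Q: "Q 0 = P" "\<And>j. refinement_step W S (Q j) (Q (Suc j))" by blast
    have r: "(refinement_step W S)\<^sup>*\<^sup>* P (Q j)" for j
      by (induction j) (use Q in \<open>auto intro: rtranclp.rtrancl_into_rtrancl\<close>)
    have "j \<le> card (Q j)" for j
    proof (induction j)
      case (Suc j)
      then show ?case using step[OF r Q(2), of j] by linarith
    qed simp
    then show False using inv[OF r, of "Suc (card R)"] by (metis Suc_n_not_le_n order.trans)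
  qed
  then show ?thesis using out Q0 by blast
qed

end

context finite_coxeter_system
begin

section \<open>The partition defined by a set of roots\<close>

text \<open>The walls of B that separate w from the identity: \<beta> is positive at the identity,
  and its sign at w is that of the root \<open>act (inv w) \<beta>\<close>.\<close>

definition inverted :: "('a \<Rightarrow> real) set \<Rightarrow> 'a \<Rightarrow> ('a \<Rightarrow> real) set" where
  "inverted B w = {\<beta> \<in> B. ht (act (inv w) \<beta>) < 0}"

text \<open>The regions cut out by the walls of B, each given as the set of its chambers.\<close>

definition root_partition :: "('a \<Rightarrow> real) set \<Rightarrow> 'a set set" where
  "root_partition B = {{v \<in> carrier W. inverted B v = inverted B w} | w. w \<in> carrier W}"

lemma root_partition_on: "partition_on (carrier W) (root_partition B)"
  by (rule partition_onI) (auto simp: root_partition_def disjnt_iff)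

lemma finite_root_partition:
  assumes "finite B"
  shows "finite (root_partition B)"
proof (rule finite_subset)
  show "root_partition B \<subseteq> (\<lambda>C. {v \<in> carrier W. inverted B v = C}) ` Pow B"
    unfolding root_partition_def inverted_def by blast
qed (use assms in simp)

lemma root_partition_inverted:
  assumes "P \<in> root_partition B" "v \<in> P" "w \<in> P"
  shows "v \<in> carrier W" "w \<in> carrier W" "inverted B v = inverted B w"
  using assms by (auto simp: root_partition_def)

lemma left_descents_eq:
  assumes "w \<in> carrier W"
  shows "left_descents W S w = {s \<in> S. ht (act (inv w) (simple_root s)) < 0}"
proof -
  have "int (len (s \<otimes> w)) = int (len w) - 1 \<longleftrightarrow> ht (act (inv w) (simple_root s)) < 0"
    if s: "s \<in> S" for s
  proof -
    have w': "inv w \<in> carrier W" using assms by simp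
    have "len (s \<otimes> w) = len (inv w \<otimes> s)"
      using len_inv[of "s \<otimes> w"] assms s by (simp add: inv_mult_group)
    then show ?thesis
      using ht_act_simple_neg_iff[OF w' s] len_mult_cases[OF w' s] assms by auto
  qed
  then show ?thesis unfolding left_descents_def by blast
qed

lemma root_partition_locally_constant:
  assumes "simple_root ` S \<subseteq> B"
  shows "locally_constant W S (root_partition B)"
  unfolding locally_constant_def
proof (intro conjI ballI)
  show "partition_on (carrier W) (root_partition B)" by (rule root_partition_on)
  fix P v w assume P: "P \<in> root_partition B" "v \<in> P" "w \<in> P"
  have "left_descents W S u = {s \<in> S. simple_root s \<in> inverted B u}" if "u \<in> carrier W" for u
    using assms that by (auto simp: left_descents_eq inverted_def)
  then show "left_descents W S v = left_descents W S w"
    using root_partition_inverted[OF P] by simp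
qed

text \<open>
  If \<open>\<langle>\<beta>, \<alpha>\<^sub>s\<rangle> \<le> - 1\<close> then \<open>s \<beta>\<close> dominates \<open>\<alpha>\<^sub>s\<close>, so it is not inverted by
  elements without the left descent \<open>s\<close>.
\<close>

lemma root_partition_regular:
  assumes simple: "simple_root ` S \<subseteq> B" and Bp: "B \<subseteq> \<Phi>p"
    and closed: "\<And>\<beta> s. \<lbrakk>\<beta> \<in> B; s \<in> S; \<beta> \<noteq> simple_root s; form \<beta> (simple_root s) > - 1\<rbrakk> \<Longrightarrow> refl s \<beta> \<in> B"
  shows "regular_partition W S (root_partition B)"
proof -
  note lc = root_partition_locally_constant[OF simple]
  have "\<exists>P'\<in>root_partition B. s <# P \<subseteq> P'"
    if P: "P \<in> root_partition B" and s: "s \<in> S - part_descents W S P" for P s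
  proof -
    obtain w where w: "w \<in> carrier W" "w \<in> P" using P by (auto simp: root_partition_def)
    have sS: "s \<in> S" using s by blast
    have "inverted B (s \<otimes> u) = inverted B (s \<otimes> w)" if u: "u \<in> P" for u
    proof -
      have uW: "u \<in> carrier W" and eq: "inverted B u = inverted B w"
        using root_partition_inverted[OF P u w(2)] by auto
      have act: "act (inv (s \<otimes> v)) \<beta> = act (inv v) (refl s \<beta>)" if "v \<in> carrier W" for v \<beta>
        using that sS by (simp add: inv_mult_group act_mult act_S)
      have nd: "\<not> ht (act (inv v) (simple_root s)) < 0" if "v \<in> P" "v \<in> carrier W" for v
        using s left_descents_eq[OF that(2)] part_descents_eq[OF lc P that(1)] by blast
      \<comment> \<open>There are three cases. For \<beta> = \<alpha>_s the reflected root is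
        -\<alpha>_s, negative at all elements of P. If s\<beta> lies in B, the elements of P agree
        on it by definition. Otherwise it dominates \<alpha>_s and is positive at all of
        them.\<close>
      have "ht (act (inv u) (refl s \<beta>)) < 0 \<longleftrightarrow> ht (act (inv w) (refl s \<beta>)) < 0" if \<beta>: "\<beta> \<in> B" for \<beta>
      proof (cases "\<beta> = simple_root s")
        case True
        have "ht (act (inv v) (refl s \<beta>)) < 0" if "v \<in> P" "v \<in> carrier W" for v
          using nd[OF that] ht_act_pos_or_neg[of "inv v" "simple_root s"] that sS
          by (simp add: True refl_simple_same act_uminus ht_uminus)
        then show ?thesis using u uW w by blast
      next
        case False
        show ?thesis
        proof (cases "form \<beta> (simple_root s) > - 1")
          case True
          then have "refl s \<beta> \<in> B" using closed \<beta> sS False by blast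
          then show ?thesis using eq unfolding inverted_def by blast
        next
          case le: False
          have \<beta>p: "\<beta> \<in> \<Phi>p" using \<beta> Bp by blast
          have "refl s \<beta> \<in> \<Phi>p" using refl_positive[OF \<beta>p sS False] .
          then have "dominates (refl s \<beta>) (simple_root s)"
            using dominates_simple_iff(1)[of "refl s \<beta>" s] refl_neq_simple_root[OF \<beta>p sS] le sS
              form_refl_simple[OF sS, of \<beta>] by simp
          then have "\<not> ht (act (inv v) (refl s \<beta>)) < 0" if "v \<in> P" "v \<in> carrier W" for v
            using nd[OF that] dominatesD that by blast
          then show ?thesis using u uW w by blast
        qed
      qed
      then show ?thesis unfolding inverted_def using act uW w(1) by auto
    qed
    then have "s <# P \<subseteq> {v \<in> carrier W. inverted B v = inverted B (s \<otimes> w)}"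
      unfolding l_coset_subset_iff using root_partition_inverted[OF P _ w(2)] sS by blast
    moreover have "{v \<in> carrier W. inverted B v = inverted B (s \<otimes> w)} \<in> root_partition B"
      unfolding root_partition_def using w(1) sS by blast
    ultimately show ?thesis by blast
  qed
  then show ?thesis using lc unfolding regular_partition_def by blast
qed

section \<open>Crossing walls along a gallery\<close>

lemma ht_refl_neg_iff:
  assumes "\<beta> \<in> \<Phi>" "s \<in> S" "\<beta> \<noteq> simple_root s" "(\<lambda>t. - \<beta> t) \<noteq> simple_root s"
  shows "ht (refl s \<beta>) < 0 \<longleftrightarrow> ht \<beta> < 0"
proof (cases "ht \<beta> < 0")
  case True
  then have "(\<lambda>t. - \<beta> t) \<in> \<Phi>p" using uminus_root assms by (simp add: positive_root_iff ht_uminus)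
  then have "refl s (\<lambda>t. - \<beta> t) \<in> \<Phi>p" using refl_positive assms by blast
  moreover have "refl s (\<lambda>t. - \<beta> t) = (\<lambda>t. - refl s \<beta> t)"
    using act_uminus[of s \<beta>] assms(2) by (simp add: act_S)
  ultimately show ?thesis using True by (simp add: positive_root_iff ht_uminus)
next
  case False
  then have "\<beta> \<in> \<Phi>p" using assms ht_root_nonzero[OF assms(1)] by (simp add: positive_root_iff)
  then have "refl s \<beta> \<in> \<Phi>p" using refl_positive assms by blast
  then show ?thesis using False by (simp add: positive_root_iff)
qed

text \<open>
  A reduced word of \<open>v\<^sup>-\<^sup>1 w\<close> describes a gallery from \<open>v\<close> to \<open>w\<close> which crosses only walls
  separating \<open>v\<close> from \<open>w\<close>.
\<close>

lemma same_part_if_inverted_eq: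
  assumes part: "partition_on (carrier W) \<P>" and A: "roots_of_partition W S \<P> \<subseteq> A" "A \<subseteq> \<Phi>p"
    and Q: "Q \<in> \<P>"
    and "v \<in> Q" "u \<in> carrier W" "inverted A v = inverted A (v \<otimes> u)"
  shows "v \<otimes> u \<in> Q"
  using assms(5-7)
proof (induction "len u" arbitrary: u v rule: less_induct)
  case less
  have v: "v \<in> carrier W" using less.prems Q partition_onD1[OF part] by blast
  show ?case
  proof (cases "u = \<one>")
    case True
    then show ?thesis using less.prems v by simp
  next
    case False
    have u: "u \<in> carrier W" by fact
    have "inv u \<noteq> \<one>" using False u by (metis inv_inv inv_one)
    then obtain s where s: "s \<in> S" "len (inv u) = len (inv u \<otimes> s) + 1"
      using ex_right_descent[of "inv u"] u by auto
    define u' where "u' = s \<otimes> u"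
    have u': "u' \<in> carrier W" "u = s \<otimes> u'" using s(1) u by (auto simp: u'_def)
    have "inv u' = inv u \<otimes> s" using s(1) u by (simp add: u'_def inv_mult_group)
    then have "len u' = len (inv u \<otimes> s)" using len_inv[OF u'(1)] by simp
    then have lt: "len u' < len u" using s u by simp
    have neg: "ht (act (inv u) (simple_root s)) < 0"
      using ht_act_simple_neg_iff[of "inv u" s] s u by simp
    define \<gamma> where "\<gamma> = act v (simple_root s)"
    have \<gamma>: "\<gamma> \<in> \<Phi>" using act_root v s by (simp add: \<gamma>_def)
    define \<beta> where "\<beta> = (if ht \<gamma> > 0 then \<gamma> else (\<lambda>t. - \<gamma> t))"
    have \<beta>: "\<beta> \<in> \<Phi>p" using \<gamma> uminus_root[OF \<gamma>] not_positive_root[OF \<gamma>]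
      by (simp add: \<beta>_def positive_root_iff ht_uminus)
    have \<gamma>\<beta>: "\<gamma> = \<beta> \<or> \<gamma> = (\<lambda>t. - \<beta> t)" by (simp add: \<beta>_def)
    have v\<gamma>: "act (inv v) \<gamma> = simple_root s" using v by (simp add: \<gamma>_def)
    have vu\<gamma>: "act (inv (v \<otimes> u)) \<gamma> = act (inv u) (simple_root s)"
      using v u by (simp add: inv_mult_group act_mult v\<gamma>)
    \<comment> \<open>The wall of \<open>\<beta>\<close> lies between v and vs. Since s is a left
      descent of u, it also separates v from vu. Equality of the inverted sets therefore keeps
      \<open>\<beta>\<close> out of \<open>A\<close>, and the crossing cannot leave
      \<open>Q\<close>.\<close>
    have sep: "ht (act (inv v) \<beta>) < 0 \<longleftrightarrow> \<not> ht (act (inv (v \<otimes> u)) \<beta>) < 0"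
    proof (cases "ht \<gamma> > 0")
      case True
      then show ?thesis using v\<gamma> vu\<gamma> neg s by (simp add: \<beta>_def)
    next
      case False
      have "act (inv v) \<beta> = (\<lambda>t. - simple_root s t)"
        using act_uminus[of "inv v" \<gamma>] v False by (simp add: \<beta>_def v\<gamma>)
      moreover have "act (inv (v \<otimes> u)) \<beta> = (\<lambda>t. - act (inv u) (simple_root s) t)"
        using act_uminus[of "inv (v \<otimes> u)" \<gamma>] v u False by (simp add: \<beta>_def vu\<gamma>)
      ultimately show ?thesis using neg s by (simp add: ht_uminus)
    qed
    have \<beta>A: "\<beta> \<notin> A" using sep less.prems(3) unfolding inverted_def by blast
    have vs: "v \<otimes> s \<in> carrier W" using v s by simp
    then obtain Q2 where Q2: "Q2 \<in> \<P>" "v \<otimes> s \<in> Q2" using partition_onD1[OF part] by blast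
    have "Q2 = Q"
    proof (rule ccontr)
      assume "Q2 \<noteq> Q"
      then have "\<beta> \<in> roots_of_partition W S \<P>"
        using \<beta> Q Q2 less.prems(1) s(1) \<gamma>\<beta> unfolding roots_of_partition_def \<gamma>_def by blast
      then show False using \<beta>A A by blast
    qed
    then have vsQ: "v \<otimes> s \<in> Q" using Q2 by simp
    \<comment> \<open>Stepping from v to vs changes the sign of no positive root other than
      \<open>\<beta>\<close>, which is not in \<open>A\<close>.\<close>
    have "inverted A (v \<otimes> s) = inverted A v"
    proof -
      have "ht (act (inv (v \<otimes> s)) \<delta>) < 0 \<longleftrightarrow> ht (act (inv v) \<delta>) < 0" if \<delta>: "\<delta> \<in> A" for \<delta>
      proof -
        define \<eta> where "\<eta> = act (inv v) \<delta>"
        have \<delta>p: "\<delta> \<in> \<Phi>p" using \<delta> A by blast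
        have \<eta>: "\<eta> \<in> \<Phi>" using act_root[of "inv v" \<delta>] v \<delta>p by (auto simp: \<eta>_def)
        have \<delta>\<eta>: "\<delta> = act v \<eta>" using v by (simp add: \<eta>_def)
        have "\<delta> \<noteq> \<gamma>" using \<delta> \<delta>p \<beta>A by (auto simp: \<beta>_def positive_root_iff)
        then have n1: "\<eta> \<noteq> simple_root s" by (auto simp: \<delta>\<eta> \<gamma>_def)
        have n2: "(\<lambda>t. - \<eta> t) \<noteq> simple_root s"
        proof
          assume "(\<lambda>t. - \<eta> t) = simple_root s"
          then have "\<gamma> = (\<lambda>t. - \<delta> t)" using act_uminus[OF v, of \<eta>] by (simp add: \<gamma>_def \<delta>\<eta>)
          then have "\<delta> = \<beta>" using \<delta>p by (simp add: \<beta>_def positive_root_iff ht_uminus)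
          then show False using \<delta> \<beta>A by blast
        qed
        have "act (inv (v \<otimes> s)) \<delta> = refl s \<eta>"
          using v s by (simp add: inv_mult_group act_mult act_S \<eta>_def)
        then show ?thesis using ht_refl_neg_iff[OF \<eta> s(1) n1 n2] by (simp add: \<eta>_def)
      qed
      then show ?thesis unfolding inverted_def by blast
    qed
    moreover have vu: "v \<otimes> u = (v \<otimes> s) \<otimes> u'" using v s(1) u' by (simp add: m_assoc)
    ultimately have "inverted A (v \<otimes> s) = inverted A ((v \<otimes> s) \<otimes> u')" using less.prems(3) by simp
    then show ?thesis unfolding vu using less.hyps[OF lt vsQ u'(1)] by blast
  qed
qed

lemma root_partition_refines:
  assumes part: "partition_on (carrier W) \<P>"
    and A: "roots_of_partition W S \<P> \<subseteq> A" "A \<subseteq> \<Phi>p"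
  shows "refines (carrier W) (root_partition A) \<P>"
  unfolding refines_def
proof (intro conjI ballI)
  fix P assume P: "P \<in> root_partition A"
  then obtain v where v: "v \<in> carrier W" "v \<in> P" by (auto simp: root_partition_def)
  then obtain Q where Q: "Q \<in> \<P>" "v \<in> Q" using partition_onD1[OF part] by blast
  have "P \<subseteq> Q"
  proof
    fix w assume "w \<in> P"
    then have w: "w \<in> carrier W" "inverted A v = inverted A w"
      using root_partition_inverted[OF P v(2)] by auto
    have "w = v \<otimes> (inv v \<otimes> w)" using v w by (simp flip: m_assoc)
    then show "w \<in> Q"
      using same_part_if_inverted_eq[OF part A Q, of "inv v \<otimes> w"] v w by simp
  qed
  then show "\<exists>Q\<in>\<P>. P \<subseteq> Q" using Q by blast
qed (use part root_partition_on in auto)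

lemma ex_finite_regular_partition:
  assumes part: "partition_on (carrier W) \<P>" and fin: "finite (roots_of_partition W S \<P>)"
  obtains R where "regular_partition W S R" "refines (carrier W) R \<P>" "finite R"
proof -
  let ?A = "roots_of_partition W S \<P>"
  \<comment> \<open>Any common bound of these numbers would serve; the sum is one because there are
    finitely many roots to add up.\<close>
  define n where "n = (\<Sum>\<beta>\<in>?A. card (dominated \<beta>))"
  have Ap: "?A \<subseteq> \<Phi>p" by (auto simp: roots_of_partition_def)
  have "?A \<subseteq> few_dominated n"
    using Ap fin by (auto simp: few_dominated_def n_def intro!: member_le_sum)
  moreover have p: "few_dominated n \<subseteq> \<Phi>p" by (auto simp: few_dominated_def)
  ultimately have "refines (carrier W) (root_partition (few_dominated n)) \<P>"
    using root_partition_refines part by blast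
  moreover have "simple_root ` S \<subseteq> few_dominated n" using simple_root_few_dominated by blast
  then have "regular_partition W S (root_partition (few_dominated n))"
    using root_partition_regular p refl_few_dominated by blast
  ultimately show ?thesis using that finite_root_partition finite_few_dominated by blast
qed

end

theorem theorem3p28:
  fixes W :: "('a, 'b) monoid_scheme" and S :: "'a set" and \<P> :: "'a set set"
  assumes "coxeter_system W S"
    and "finite S"
    and "locally_constant W S \<P>"
    and "finite (roots_of_partition W S \<P>)"
  shows "algorithm_terminates W S \<P> \<and>
         (\<forall>\<Q>. algorithm_output W S \<P> \<Q> \<longleftrightarrow> \<Q> = regular_completion W S \<P>) \<and>
         finite (regular_completion W S \<P>)"
proof -
  interpret coxeter_system W S by fact
  interpret finite_coxeter_system W S by unfold_locales fact
  obtain R where "regular_partition W S R" "refines (carrier W) R \<P>" "finite R"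
    using ex_finite_regular_partition locally_constant_partition assms(3,4) by blast
  then show ?thesis using algorithm_correct assms(3) by blast
qed

end
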